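(* For integers $m,n\ge 1$, the number of cells in $BC_{GP}(m,n)$ is $$\mathcal{C}_{GP}(m,n) = \frac14\left\{ (m-1)^2(m-2)^2 + (n-1)^2(n-2)^2\right\} + 2mn\left(m+n-\frac32\right)^2 + \frac{9mn}{2} - 1 .$$
   Context: For integers $m,n\ge 1$, the planar graph $BC(m,n)$ is constructed as follows: take a rectangle of size $m\times n$, divide each of the two vertical sides into $m$ equal parts by $m-1$ nodes and each of the two horizontal sides into $n$ equal parts by $n-1$ nodes, giving, with the four vertices, $2(m+n)$ boundary nodes; join every pair of boundary nodes by a straight line segment (a chord). $BC_{GP}(m,n)$ ("general position") denotes a graph obtained in the same way after perturbing the boundary nodes other than the four vertices of the rectangle by small (random, independent) displacements along the sides on which they lie. The displacements are small enough that the nodes stay in the interior of their sides and keep their order, and they are such that no interior point of the rectangle lies on three or more chords. The nodes of the graph are the $2(m+n)$ boundary nodes together with the interior points at which two chords intersect; the edges are the segments between consecutive nodes along the chords (including those forming the boundary of the rectangle); the cells are the bounded connected regions (inside the rectangle) into which the edges divide the rectangle. $\mathcal{C}_{GP}(m,n)$ denotes the number of cells of $BC_{GP}(m,n)$. *)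

theory Defs
  imports "HOL-Analysis.Analysis"
begin

text \<open>
  The rectangle has horizontal side length \<open>n\<close> and vertical side length \<open>m\<close>, so that
  the unperturbed nodes dividing a side into equal parts are at unit distance from each other.
\<close>

definition rectangle :: "nat \<Rightarrow> nat \<Rightarrow> (real \<times> real) set" where
  "rectangle m n = cbox (0, 0) (real n, real m)"

definition corners :: "nat \<Rightarrow> nat \<Rightarrow> (real \<times> real) set" where
  "corners m n = {0, real n} \<times> {0, real m}"

datatype side = West | East | South | North

fun side_length :: "nat \<Rightarrow> nat \<Rightarrow> side \<Rightarrow> nat" where
  "side_length m n West = m"
| "side_length m n East = m"
| "side_length m n South = n"
| "side_length m n North = n"

fun side_point :: "nat \<Rightarrow> nat \<Rightarrow> side \<Rightarrow> real \<Rightarrow> real \<times> real" where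
  "side_point m n West x = (0, x)"
| "side_point m n East x = (real n, x)"
| "side_point m n South x = (x, 0)"
| "side_point m n North x = (x, real m)"

text \<open>
  A perturbation \<open>\<delta>\<close> displaces the \<open>i\<close>-th division node of side \<open>s\<close>, for
  \<open>0 < i < side_length m n s\<close>, by \<open>\<delta> s i\<close> along that side; all other values of
  \<open>\<delta>\<close> are irrelevant.
\<close>

type_synonym perturbation = "side \<Rightarrow> nat \<Rightarrow> real"

definition node_pos :: "perturbation \<Rightarrow> side \<Rightarrow> nat \<Rightarrow> real" where
  "node_pos \<delta> s i = real i + \<delta> s i"

definition boundary_nodes :: "nat \<Rightarrow> nat \<Rightarrow> perturbation \<Rightarrow> (real \<times> real) set" where
  "boundary_nodes m n \<delta> =
     corners m n \<union> {side_point m n s (node_pos \<delta> s i) | s i. 0 < i \<and> i < side_length m n s}"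

definition chords :: "nat \<Rightarrow> nat \<Rightarrow> perturbation \<Rightarrow> (real \<times> real) set set" where
  "chords m n \<delta> =
     {closed_segment p q | p q. p \<in> boundary_nodes m n \<delta> \<and> q \<in> boundary_nodes m n \<delta> \<and> p \<noteq> q}"

definition BC_nodes :: "nat \<Rightarrow> nat \<Rightarrow> perturbation \<Rightarrow> (real \<times> real) set" where
  "BC_nodes m n \<delta> =
     boundary_nodes m n \<delta> \<union>
     {p \<in> interior (rectangle m n).
        \<exists>c\<in>chords m n \<delta>. \<exists>d\<in>chords m n \<delta>. c \<noteq> d \<and> p \<in> c \<and> p \<in> d}"

definition BC_edges :: "nat \<Rightarrow> nat \<Rightarrow> perturbation \<Rightarrow> (real \<times> real) set set" where
  "BC_edges m n \<delta> =
     {closed_segment p q | p q c. c \<in> chords m n \<delta> \<and>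
        p \<in> BC_nodes m n \<delta> \<inter> c \<and> q \<in> BC_nodes m n \<delta> \<inter> c \<and> p \<noteq> q \<and>
        open_segment p q \<inter> BC_nodes m n \<delta> = {}}"

text \<open>
  Boundedness of the cells is automatic since they are subsets of the rectangle.
\<close>

definition BC_cells :: "nat \<Rightarrow> nat \<Rightarrow> perturbation \<Rightarrow> (real \<times> real) set set" where
  "BC_cells m n \<delta> = components (rectangle m n - \<Union> (BC_edges m n \<delta>))"

definition admissible :: "nat \<Rightarrow> nat \<Rightarrow> perturbation \<Rightarrow> bool" where
  "admissible m n \<delta> \<longleftrightarrow>
     (\<forall>s i. 0 < i \<and> i < side_length m n s \<longrightarrow>
        0 < node_pos \<delta> s i \<and> node_pos \<delta> s i < real (side_length m n s)) \<and>
     (\<forall>s i j. 0 < i \<and> i < j \<and> j < side_length m n s \<longrightarrow> node_pos \<delta> s i < node_pos \<delta> s j)"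

definition general_position :: "nat \<Rightarrow> nat \<Rightarrow> perturbation \<Rightarrow> bool" where
  "general_position m n \<delta> \<longleftrightarrow>
     \<not> (\<exists>p\<in>interior (rectangle m n). \<exists>c\<in>chords m n \<delta>. \<exists>d\<in>chords m n \<delta>. \<exists>e\<in>chords m n \<delta>.
          c \<noteq> d \<and> c \<noteq> e \<and> d \<noteq> e \<and> p \<in> c \<and> p \<in> d \<and> p \<in> e)"

end

theory Submission
  imports Defs
begin

text \<open>
  A chord joining two nodes that do not share a side is the trace of a line on the open rectangle,
  and the remaining chords lie on the boundary, so the cells are the regions of an arrangement of
  lines inside a convex open set. The regions are counted by deletion and restriction: adding a
  line creates as many new regions as there are pieces into which the older lines cut it, that is,
  one plus the number of crossings on it, all crossings being distinct in general position. Hence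
  there are \<open>1 + c + x\<close> cells, for \<open>c\<close> inner chords and \<open>x\<close> crossings. Listing the nodes
  counterclockwise, two inner chords cross iff their endpoints interleave, so \<open>x\<close> counts the
  four-element sets of nodes no three of which lie on one side, just as \<open>c\<close> counts the
  two-element sets of nodes not contained in one side.
\<close>

subsection \<open>Regions of a line arrangement in a convex open set\<close>

text \<open>Patterns replace regions because they reduce deletion and restriction to
  \<open>card A + card B = card (A \<union> B) + card (A \<inter> B)\<close>, where A and B are the
  patterns of the older forms on the two sides of the new line. Topology enters only once, when
  patterns are matched with components. The ambient set is any convex set with room on both sides of
  the new zero set, so one insertion lemma serves the plane and also the restriction to a line.
  Working in the open rectangle keeps chords that merely share a boundary node from counting as
  crossing. The excluded node sets need no second-order inclusion-exclusion: two sides share at most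
  one corner, so two nodes cannot lie doubly on two sides, nor can four nodes have three on each of
  two sides. The price of replacing the cyclic order by real parameters is that the cycle is cut at
  the origin, which makes West exceptional among the sides.\<close>

definition sign_patterns :: "('i \<Rightarrow> 'a \<Rightarrow> real) \<Rightarrow> 'a set \<Rightarrow> 'i set \<Rightarrow> 'i set set" where
  "sign_patterns h C I = (\<lambda>x. {i\<in>I. h i x > 0}) ` {x\<in>C. \<forall>i\<in>I. h i x \<noteq> 0}"

lemma finite_sign_patterns: "finite I \<Longrightarrow> finite (sign_patterns h C I)"
  unfolding sign_patterns_def by (rule finite_subset[of _ "Pow I"]) auto

text \<open>Nonvanishing of finitely many continuous forms survives a short step from
  \<open>x\<close> towards \<open>x + d\<close>, while the form of \<open>g\<close>, zero at
  \<open>x\<close>, changes linearly along it. A positive product of old and new value expresses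
  that a sign is kept.\<close>

lemma perturb_sign_pattern:
  fixes a :: "'i \<Rightarrow> 'a::real_inner"
  assumes h: "\<And>i x. h i x = a i \<bullet> x - b i" and C: "convex C" and I: "finite I"
    and x: "x \<in> C" "x + d \<in> C" "\<forall>i\<in>I. h i x \<noteq> 0" and g: "h g x = 0"
  obtains y t where "y \<in> C" "\<forall>i\<in>I. h i y \<noteq> 0" "{i\<in>I. h i y > 0} = {i\<in>I. h i x > 0}"
    "t > 0" "h g y = t * (a g \<bullet> d)"
proof -
  have "\<forall>\<^sub>F t in at_right 0. h i x * h i (x + t *\<^sub>R d) > 0" if "i \<in> I" for i
  proof -
    have "((\<lambda>t. h i x * h i (x + t *\<^sub>R d)) \<longlongrightarrow> h i x * h i (x + 0 *\<^sub>R d)) (at_right 0)"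
      unfolding h by (intro tendsto_intros)
    moreover have "h i x * h i (x + 0 *\<^sub>R d) > 0"
      using x(3) that by (auto simp: zero_less_mult_iff) 
    ultimately show ?thesis by (rule order_tendstoD)
  qed
  then have "\<forall>\<^sub>F t in at_right 0. \<forall>i\<in>I. h i x * h i (x + t *\<^sub>R d) > 0"
    using I by (simp add: eventually_ball_finite)
  moreover have "\<forall>\<^sub>F t in at_right (0::real). 0 < t \<and> t < 1"
    using eventually_at_right_real[of 0 1] by (auto elim: eventually_mono)
  ultimately have "\<forall>\<^sub>F t in at_right 0. (\<forall>i\<in>I. h i x * h i (x + t *\<^sub>R d) > 0) \<and> 0 < t \<and> t < 1"
    by (rule eventually_conj)
  then obtain t where t: "\<forall>i\<in>I. h i x * h i (x + t *\<^sub>R d) > 0" "0 < t" "t < 1"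
    using eventually_happens'[OF trivial_limit_at_right_real] by blast
  have "(1 - t) *\<^sub>R x + t *\<^sub>R (x + d) \<in> C"
    using convexD[OF C x(1,2), of "1 - t" t] t by simp
  then have "x + t *\<^sub>R d \<in> C"
    by (simp add: algebra_simps)
  moreover have "h g (x + t *\<^sub>R d) = t * (a g \<bullet> d)"
    using g by (simp add: h inner_right_distrib)
  moreover have "\<forall>i\<in>I. h i (x + t *\<^sub>R d) \<noteq> 0"
    using t(1) by force
  moreover have "{i\<in>I. h i (x + t *\<^sub>R d) > 0} = {i\<in>I. h i x > 0}"
    using t(1) by (force simp: zero_less_mult_iff)
  ultimately show thesis using that t(2) by blast
qed

text \<open>With \<open>g\<close> present the patterns number \<open>card pos + card neg\<close>;
  without it they form the union of \<open>pos\<close> and \<open>neg\<close>; on the zero set of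
  \<open>g\<close> they form the intersection. The hypothesis on \<open>d\<close> holds in an open
  set, and also in the part of a line inside an open set if the form is not constant along the
  line.\<close>

lemma card_sign_patterns_insert:
  fixes a :: "'i \<Rightarrow> 'a::real_inner"
  assumes h: "\<And>i x. h i x = a i \<bullet> x - b i" and C: "convex C" and I: "finite I" "g \<notin> I"
    and d: "\<And>x. x \<in> C \<Longrightarrow> h g x = 0 \<Longrightarrow> \<exists>d. a g \<bullet> d \<noteq> 0 \<and> x + d \<in> C \<and> x - d \<in> C"
  shows "card (sign_patterns h C (insert g I)) =
    card (sign_patterns h C I) + card (sign_patterns h {x\<in>C. h g x = 0} I)"
proof -
  define pos where "pos = sign_patterns h {x\<in>C. h g x > 0} I"
  define neg where "neg = sign_patterns h {x\<in>C. h g x < 0} I"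
  have fin: "finite pos" "finite neg"
    unfolding pos_def neg_def using I(1) by (auto intro: finite_sign_patterns)
  have nin: "g \<notin> X" if "X \<in> pos \<union> neg" for X
    using that I(2) by (auto simp: pos_def neg_def sign_patterns_def)
  have split: "sign_patterns h C (insert g I) = insert g ` pos \<union> neg"
  proof (intro equalityI subsetI)
    fix X assume "X \<in> sign_patterns h C (insert g I)"
    then obtain x where x: "x \<in> C" "\<forall>i\<in>insert g I. h i x \<noteq> 0" "X = {i\<in>insert g I. h i x > 0}"
      by (auto simp: sign_patterns_def)
    show "X \<in> insert g ` pos \<union> neg"
    proof (cases "h g x > 0")
      case True
      then have "X = insert g {i\<in>I. h i x > 0}" using x by auto
      moreover have "{i\<in>I. h i x > 0} \<in> pos"
        unfolding pos_def sign_patterns_def using x True by blast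
      ultimately show ?thesis by blast
    next
      case False
      then have "h g x < 0" using x(2) by (simp add: less_le)
      moreover have "X = {i\<in>I. h i x > 0}" using x False by auto
      ultimately have "X \<in> neg"
        unfolding neg_def sign_patterns_def using x by blast
      then show ?thesis by blast
    qed
  next
    fix X assume "X \<in> insert g ` pos \<union> neg"
    then consider (1) x where "x \<in> C" "\<forall>i\<in>I. h i x \<noteq> 0" "h g x > 0" "X = insert g {i\<in>I. h i x > 0}"
      | (2) x where "x \<in> C" "\<forall>i\<in>I. h i x \<noteq> 0" "h g x < 0" "X = {i\<in>I. h i x > 0}"
      by (auto simp: pos_def neg_def sign_patterns_def)
    then show "X \<in> sign_patterns h C (insert g I)"
    proof cases
      case 1
      then have "X = {i\<in>insert g I. h i x > 0}" by auto
      then show ?thesis using 1 by (force simp: sign_patterns_def)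
    next
      case 2
      then have "X = {i\<in>insert g I. h i x > 0}" by auto
      then show ?thesis using 2 by (force simp: sign_patterns_def)
    qed
  qed
  \<comment> \<open>The steps \<open>d\<close> and \<open>- d\<close> change the form of
    \<open>g\<close> in opposite directions, so one leads to each side.\<close>
  have perturb: "{i\<in>I. h i x > 0} \<in> pos \<inter> neg"
    if x: "x \<in> C" "\<forall>i\<in>I. h i x \<noteq> 0" "h g x = 0" for x
  proof -
    obtain d where d: "a g \<bullet> d \<noteq> 0" "x + d \<in> C" "x - d \<in> C"
      using assms(5) x by blast
    have *: "{i\<in>I. h i x > 0} \<in> pos" if e: "a g \<bullet> e > 0" "x + e \<in> C" for e
    proof -
      obtain y t where y: "y \<in> C" "\<forall>i\<in>I. h i y \<noteq> 0" "{i\<in>I. h i y > 0} = {i\<in>I. h i x > 0}"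
        "t > 0" "h g y = t * (a g \<bullet> e)"
        using perturb_sign_pattern[OF h C I(1) x(1) e(2) x(2,3)] by blast
      have "h g y > 0" using y e by simp
      then show ?thesis unfolding pos_def sign_patterns_def
        using y(1,2) y(3)[symmetric] by (intro image_eqI[of _ _ y]) auto
    qed
    have **: "{i\<in>I. h i x > 0} \<in> neg" if e: "a g \<bullet> e < 0" "x + e \<in> C" for e
    proof -
      obtain y t where y: "y \<in> C" "\<forall>i\<in>I. h i y \<noteq> 0" "{i\<in>I. h i y > 0} = {i\<in>I. h i x > 0}"
        "t > 0" "h g y = t * (a g \<bullet> e)"
        using perturb_sign_pattern[OF h C I(1) x(1) e(2) x(2,3)] by blast
      have "h g y < 0" using y e by (simp add: mult_pos_neg)
      then show ?thesis unfolding neg_def sign_patterns_def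
        using y(1,2) y(3)[symmetric] by (intro image_eqI[of _ _ y]) auto
    qed
    show ?thesis
      using *[of d] *[of "-d"] **[of d] **[of "-d"] d by (cases "a g \<bullet> d > 0") auto
  qed
  have un: "sign_patterns h C I = pos \<union> neg"
  proof (intro equalityI subsetI)
    fix X assume "X \<in> sign_patterns h C I"
    then obtain x where x: "x \<in> C" "\<forall>i\<in>I. h i x \<noteq> 0" "X = {i\<in>I. h i x > 0}"
      by (auto simp: sign_patterns_def)
    consider "h g x > 0" | "h g x < 0" | "h g x = 0" by linarith
    then show "X \<in> pos \<union> neg"
    proof cases
      case 1 then have "X \<in> pos" unfolding pos_def sign_patterns_def using x by blast
      then show ?thesis ..
    next
      case 2 then have "X \<in> neg" unfolding neg_def sign_patterns_def using x by blast
      then show ?thesis ..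
    next
      case 3 then show ?thesis using perturb x by blast
    qed
  qed (auto simp: pos_def neg_def sign_patterns_def)
  have int: "sign_patterns h {x\<in>C. h g x = 0} I = pos \<inter> neg"
  proof (intro equalityI subsetI)
    fix X assume "X \<in> sign_patterns h {x\<in>C. h g x = 0} I"
    then show "X \<in> pos \<inter> neg" using perturb by (auto simp: sign_patterns_def)
  next
    fix X assume "X \<in> pos \<inter> neg"
    then obtain x y where x: "x \<in> C" "\<forall>i\<in>I. h i x \<noteq> 0" "X = {i\<in>I. h i x > 0}" "h g x > 0"
      and y: "y \<in> C" "\<forall>i\<in>I. h i y \<noteq> 0" "X = {i\<in>I. h i y > 0}" "h g y < 0"
      by (auto simp: pos_def neg_def sign_patterns_def)
    \<comment> \<open>The segment from \<open>x\<close> to \<open>y\<close> meets the zero set of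
      \<open>g\<close> at this parameter. Every other form has the same sign at both ends, hence at
      \<open>z\<close>.\<close>
    define u where "u = h g x / (h g x - h g y)"
    define z where "z = (1 - u) *\<^sub>R x + u *\<^sub>R y"
    have u: "0 < u" "u < 1" using x y by (auto simp: u_def field_simps)
    have hz: "h i z = (1 - u) * h i x + u * h i y" for i
      by (simp add: h z_def inner_right_distrib algebra_simps)
    have z: "z \<in> C" unfolding z_def using convexD[OF C x(1) y(1), of "1 - u" u] u by simp
    have "h g z = 0"
    proof -
      have "h g z = h g x - u * (h g x - h g y)" by (simp add: hz algebra_simps)
      then show ?thesis using x y by (simp add: u_def)
    qed
    have sgn: "h i z \<noteq> 0 \<and> (h i z > 0 \<longleftrightarrow> h i x > 0)" if "i \<in> I" for i
    proof (cases "h i x > 0")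
      case True
      then have "h i y > 0" using x(3) y(3) that by blast
      then have "h i z > 0" using True u by (simp add: hz add_pos_pos)
      then show ?thesis using True by simp
    next
      case False
      then have "\<not> h i y > 0" using x(3) y(3) that by blast
      then have "h i x < 0" "h i y < 0" using False x(2) y(2) that by force+
      then have "h i z < 0" using u by (simp add: hz add_neg_neg mult_pos_neg)
      then show ?thesis using False by simp
    qed
    have "X = {i\<in>I. h i z > 0}" using sgn x(3) by blast
    then show "X \<in> sign_patterns h {x\<in>C. h g x = 0} I"
      unfolding sign_patterns_def using z \<open>h g z = 0\<close> sgn by blast
  qed
  have "inj_on (insert g) pos"
  proof (rule inj_onI)
    fix X Y assume "X \<in> pos" "Y \<in> pos" "insert g X = insert g Y"
    then show "X = Y" using nin[of X] nin[of Y] insert_ident[of g X Y] by simp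
  qed
  moreover have "insert g ` pos \<inter> neg = {}" using nin by blast
  ultimately have "card (sign_patterns h C (insert g I)) = card pos + card neg"
    unfolding split using fin by (simp add: card_Un_disjoint card_image)
  then show ?thesis
    unfolding un int using card_Un_Int[OF fin] by simp
qed

lemma open_symmetric_step:
  fixes x v :: "'a::real_normed_vector"
  assumes "open C" "x \<in> C"
  obtains e where "e > 0" "x + e *\<^sub>R v \<in> C" "x - e *\<^sub>R v \<in> C"
proof -
  obtain r where r: "r > 0" "ball x r \<subseteq> C" using assms openE by blast
  \<comment> \<open>Adding 1 to the norm keeps the denominator positive for
    \<open>v = 0\<close>.\<close>
  define e where "e = r / (2 * (norm v + 1))"
  have nv: "norm v + 1 > 0" by (simp add: add_nonneg_pos)
  then have e: "e > 0" using r by (simp add: e_def)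
  have "e * norm v < e * (norm v + 1)" using e by simp
  also have "\<dots> = r / 2" using nv by (simp add: e_def field_simps)
  also have "\<dots> < r" using r by simp
  finally have "x + e *\<^sub>R v \<in> C" "x - e *\<^sub>R v \<in> C"
    using r(2) e by (auto simp: dist_norm subset_iff)
  then show thesis using that e by blast
qed

text \<open>Cramer's rule: the determinant times either coordinate of \<open>w\<close> is zero.
  Hence two lines with independent normals have at most one common point.\<close>

lemma orthogonal_to_independent:
  fixes a b w :: "real \<times> real"
  assumes "fst a * snd b - snd a * fst b \<noteq> 0" "a \<bullet> w = 0" "b \<bullet> w = 0"
  shows "w = 0"
proof -
  have "fst a * fst w + snd a * snd w = 0" "fst b * fst w + snd b * snd w = 0"
    using assms(2,3) by (simp_all only: inner_prod_def inner_real_def)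
  then have "fst w * (fst a * snd b - snd a * fst b) = 0" "snd w * (fst a * snd b - snd a * fst b) = 0"
    by algebra+
  then show ?thesis using assms(1) by (auto simp: prod_eq_iff)
qed

text \<open>The insertion lemma one dimension lower: a form either misses \<open>D\<close> or cuts
  it in a single point, which carries exactly one pattern. By \<open>uniq\<close> different forms
  cut at different points, so counting forms counts cuts.\<close>

lemma card_sign_patterns_line:
  fixes a :: "'i \<Rightarrow> real \<times> real"
  assumes h: "\<And>i x. h i x = a i \<bullet> x - b i" and C: "convex C" "open C"
    and D: "D = {x\<in>C. h g x = 0}" "D \<noteq> {}" and I: "finite I"
    and det: "\<And>i x. i \<in> I \<Longrightarrow> x \<in> D \<Longrightarrow> h i x = 0 \<Longrightarrow>
      fst (a g) * snd (a i) - snd (a g) * fst (a i) \<noteq> 0"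
    and uniq: "\<And>i j x. i \<in> I \<Longrightarrow> j \<in> I \<Longrightarrow> i \<noteq> j \<Longrightarrow> x \<in> D \<Longrightarrow> h i x = 0 \<Longrightarrow> h j x \<noteq> 0"
  shows "card (sign_patterns h D I) = 1 + card {i\<in>I. \<exists>x\<in>D. h i x = 0}"
  using I det uniq
proof (induction I)
  case empty
  have "sign_patterns h D {} = {{}}" using D(2) by (auto simp: sign_patterns_def)
  then show ?case by simp
next
  case (insert f I)
  have "convex D"
  proof -
    have "D = C \<inter> {x. a g \<bullet> x = b g}" by (auto simp: D(1) h)
    then show ?thesis using C(1) by (simp add: convex_Int convex_hyperplane)
  qed
  have "\<exists>d. a f \<bullet> d \<noteq> 0 \<and> x + d \<in> D \<and> x - d \<in> D" if x: "x \<in> D" "h f x = 0" for x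
  proof -
    \<comment> \<open>The direction of the line \<open>h g x = 0\<close>: the normal turned by a
      right angle. Its inner product with \<open>a f\<close> is the determinant in
      \<open>det\<close>.\<close>
    define v where "v = (- snd (a g), fst (a g))"
    obtain e where e: "e > 0" "x + e *\<^sub>R v \<in> C" "x - e *\<^sub>R v \<in> C"
      using open_symmetric_step[OF C(2)] x by (metis (lifting) D(1) mem_Collect_eq)
    have "a g \<bullet> v = 0" by (simp add: v_def inner_prod_def)
    then have "x + e *\<^sub>R v \<in> D" "x - e *\<^sub>R v \<in> D"
      using e x unfolding D(1) by (auto simp: h inner_right_distrib inner_diff_right)
    moreover have "a f \<bullet> v \<noteq> 0"
      using insert.prems(1)[of f x] x by (simp add: v_def inner_prod_def algebra_simps)
    ultimately show ?thesis using e by (intro exI[of _ "e *\<^sub>R v"]) simp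
  qed
  then have rec: "card (sign_patterns h D (insert f I)) =
      card (sign_patterns h D I) + card (sign_patterns h {x\<in>D. h f x = 0} I)"
    by (intro card_sign_patterns_insert[OF h \<open>convex D\<close> insert.hyps(1,2)])
  have IH: "card (sign_patterns h D I) = 1 + card {i\<in>I. \<exists>x\<in>D. h i x = 0}"
    using insert.prems by (intro insert.IH) blast+
  show ?case
  proof (cases "\<exists>x\<in>D. h f x = 0")
    case False
    then have "sign_patterns h {x\<in>D. h f x = 0} I = {}" unfolding sign_patterns_def by blast
    moreover have "{i\<in>insert f I. \<exists>x\<in>D. h i x = 0} = {i\<in>I. \<exists>x\<in>D. h i x = 0}"
      using False by blast
    ultimately show ?thesis using rec IH by simp
  next
    case True
    then obtain p where p: "p \<in> D" "h f p = 0" by blast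
    have "x = p" if x: "x \<in> D" "h f x = 0" for x
    proof -
      have "a g \<bullet> (x - p) = 0" "a f \<bullet> (x - p) = 0"
        using x p by (auto simp: D(1) h inner_diff_right)
      then have "x - p = 0"
        by (rule orthogonal_to_independent[rotated]) (use insert.prems(1)[of f p] p in auto)
      then show ?thesis by simp
    qed
    then have "{x\<in>D. h f x = 0} = {p}" using p by blast
    \<comment> \<open>By \<open>uniq\<close> no form of \<open>I\<close> vanishes at
      \<open>p\<close>, so the point is not discarded.\<close>
    moreover have "sign_patterns h {p} I = {{i\<in>I. h i p > 0}}"
      using insert.prems(2)[of f _ p] insert.hyps(2) p by (force simp: sign_patterns_def)
    moreover have "{i\<in>insert f I. \<exists>x\<in>D. h i x = 0} = insert f {i\<in>I. \<exists>x\<in>D. h i x = 0}"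
      using True by blast
    ultimately show ?thesis using rec IH insert.hyps by simp
  qed
qed

text \<open>
  The relation \<open>L\<close> orients each crossing pair of lines, so that crossings are counted as ordered pairs.
\<close>

lemma card_sign_patterns_plane:
  fixes a :: "'i \<Rightarrow> real \<times> real"
  assumes h: "\<And>i x. h i x = a i \<bullet> x - b i" and C: "convex C" "open C" and I: "finite I"
    and C0: "C \<noteq> {}"
    and meets: "\<And>i. i \<in> I \<Longrightarrow> \<exists>x\<in>C. h i x = 0" and nz: "\<And>i. i \<in> I \<Longrightarrow> a i \<noteq> 0"
    and det: "\<And>i j x. i \<in> I \<Longrightarrow> j \<in> I \<Longrightarrow> i \<noteq> j \<Longrightarrow> x \<in> C \<Longrightarrow> h i x = 0 \<Longrightarrow> h j x = 0 \<Longrightarrow>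
      fst (a i) * snd (a j) - snd (a i) * fst (a j) \<noteq> 0"
    and uniq: "\<And>i j k x. i \<in> I \<Longrightarrow> j \<in> I \<Longrightarrow> k \<in> I \<Longrightarrow> i \<noteq> j \<Longrightarrow> i \<noteq> k \<Longrightarrow> j \<noteq> k \<Longrightarrow> x \<in> C \<Longrightarrow>
      h i x = 0 \<Longrightarrow> h j x = 0 \<Longrightarrow> h k x \<noteq> 0"
    and asym: "\<And>i j. L i j \<Longrightarrow> \<not> L j i"
    and cross: "\<And>i j. i \<in> I \<Longrightarrow> j \<in> I \<Longrightarrow> i \<noteq> j \<Longrightarrow>
      (\<exists>x\<in>C. h i x = 0 \<and> h j x = 0) \<longleftrightarrow> L i j \<or> L j i"
  shows "card (sign_patterns h C I) = 1 + card I + card {(i, j). i \<in> I \<and> j \<in> I \<and> L i j}"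
  using I meets nz det uniq cross
proof (induction I)
  case empty
  have "sign_patterns h C {} = {{}}" using C0 by (auto simp: sign_patterns_def)
  then show ?case by simp
next
  case (insert g I)
  define D where "D = {x\<in>C. h g x = 0}"
  have "\<exists>d. a g \<bullet> d \<noteq> 0 \<and> x + d \<in> C \<and> x - d \<in> C" if x: "x \<in> C" for x
  proof -
    obtain e where "e > 0" "x + e *\<^sub>R a g \<in> C" "x - e *\<^sub>R a g \<in> C"
      using open_symmetric_step[OF C(2) x] by blast
    then show ?thesis using insert.prems(2)[of g] by (intro exI[of _ "e *\<^sub>R a g"]) simp
  qed
  then have rec: "card (sign_patterns h C (insert g I)) =
      card (sign_patterns h C I) + card (sign_patterns h D I)"
    unfolding D_def by (intro card_sign_patterns_insert[OF h C(1) insert.hyps]) blast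
  have IH: "card (sign_patterns h C I) = 1 + card I + card {(i, j). i \<in> I \<and> j \<in> I \<and> L i j}"
    by (intro insert.IH insert.prems; blast)
  have line: "card (sign_patterns h D I) = 1 + card {i\<in>I. \<exists>x\<in>D. h i x = 0}"
  proof (rule card_sign_patterns_line[where g = g and h = h and a = a and b = b, OF h C D_def _ insert.hyps(1)])
    show "D \<noteq> {}" using insert.prems(1)[of g] by (auto simp: D_def)
  next
    fix i x assume "i \<in> I" "x \<in> D" "h i x = 0"
    then show "fst (a g) * snd (a i) - snd (a g) * fst (a i) \<noteq> 0"
      using insert.prems(3)[of g i x] insert.hyps(2) by (auto simp: D_def)
  next
    fix i j x assume "i \<in> I" "j \<in> I" "i \<noteq> j" "x \<in> D" "h i x = 0"
    then show "h j x \<noteq> 0"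
      using insert.prems(4)[of g i j x] insert.hyps(2) by (auto simp: D_def)
  qed
  define M where "M = {(i, j). i \<in> I \<and> j \<in> I \<and> L i j}"
  have irrefl: "\<not> L g g" using asym by blast
  \<comment> \<open>The new pairs are sorted by the place of \<open>g\<close>; asymmetry of
    \<open>L\<close> lets each line crossing \<open>g\<close> contribute exactly one of
    them.\<close>
  have M: "{(i, j). i \<in> insert g I \<and> j \<in> insert g I \<and> L i j} =
      M \<union> (Pair g ` {i\<in>I. L g i} \<union> (\<lambda>i. (i, g)) ` {i\<in>I. L i g})"
    using irrefl by (auto simp: M_def)
  have "finite M"
    by (rule finite_subset[of _ "I \<times> I"]) (use insert.hyps in \<open>auto simp: M_def\<close>)
  have "(\<exists>x\<in>D. h i x = 0) \<longleftrightarrow> L g i \<or> L i g" if "i \<in> I" for i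
  proof -
    have "(\<exists>x\<in>C. h g x = 0 \<and> h i x = 0) \<longleftrightarrow> L g i \<or> L i g"
      using insert.hyps(2) that by (intro insert.prems(5)) auto
    then show ?thesis unfolding D_def by blast
  qed
  then have "{i\<in>I. \<exists>x\<in>D. h i x = 0} = {i\<in>I. L g i} \<union> {i\<in>I. L i g}"
    by blast
  moreover have "{i\<in>I. L g i} \<inter> {i\<in>I. L i g} = {}" using asym by blast
  ultimately have "card {i\<in>I. \<exists>x\<in>D. h i x = 0} = card {i\<in>I. L g i} + card {i\<in>I. L i g}"
    using insert.hyps(1) by (simp add: card_Un_disjoint)
  moreover have "card (M \<union> (Pair g ` {i\<in>I. L g i} \<union> (\<lambda>i. (i, g)) ` {i\<in>I. L i g})) =
      card M + (card {i\<in>I. L g i} + card {i\<in>I. L i g})"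
  proof (subst card_Un_disjoint)
    have "card (Pair g ` {i\<in>I. L g i} \<union> (\<lambda>i. (i, g)) ` {i\<in>I. L i g}) =
        card (Pair g ` {i\<in>I. L g i}) + card ((\<lambda>i. (i, g)) ` {i\<in>I. L i g})"
      using insert.hyps by (intro card_Un_disjoint) auto
    then show "card M + card (Pair g ` {i\<in>I. L g i} \<union> (\<lambda>i. (i, g)) ` {i\<in>I. L i g}) =
        card M + (card {i\<in>I. L g i} + card {i\<in>I. L i g})"
      by (simp add: card_image inj_on_def)
  qed (use insert.hyps \<open>finite M\<close> in \<open>auto simp: M_def\<close>)
  ultimately show ?case
    unfolding M rec line IH M_def[symmetric] using insert.hyps by simp
qed

text \<open>A connected set avoiding all the zero sets cannot change a sign, by the intermediate
  value theorem. Conversely, the points with a given pattern form an intersection of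
  \<open>C\<close> with half-spaces, which is convex and so connected.\<close>

lemma card_components_sign_patterns:
  fixes a :: "'i \<Rightarrow> 'a::euclidean_space"
  assumes h: "\<And>i x. h i x = a i \<bullet> x - b i" and C: "convex C"
  shows "card (components {x\<in>C. \<forall>i\<in>I. h i x \<noteq> 0}) = card (sign_patterns h C I)"
proof -
  define W where "W = {x\<in>C. \<forall>i\<in>I. h i x \<noteq> 0}"
  define pat where "pat x = {i\<in>I. h i x > 0}" for x
  have cc: "connected_component_set W x = {y\<in>W. pat y = pat x}" if "x \<in> W" for x
  proof (intro equalityI subsetI)
    fix y assume "y \<in> connected_component_set W x"
    then obtain S where S: "connected S" "S \<subseteq> W" "x \<in> S" "y \<in> S"
      by (auto simp: connected_component_def)
    \<comment> \<open>Stated for arbitrary points of \<open>S\<close>, so that it applies in both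
      directions.\<close>
    have "h i y > 0" if "i \<in> I" "h i x > 0" "x \<in> S" "y \<in> S" for i x y
    proof (rule ccontr)
      assume "\<not> h i y > 0"
      then have "\<exists>z\<in>S. a i \<bullet> z = b i"
        using connected_ivt_hyperplane[OF S(1) that(4,3), of "a i" "b i"] that by (auto simp: h)
      then show False using S(2) \<open>i \<in> I\<close> by (auto simp: W_def h)
    qed
    then have "pat y = pat x" using S by (auto simp: pat_def)
    then show "y \<in> {y\<in>W. pat y = pat x}" using S by blast
  next
    fix y assume y: "y \<in> {y\<in>W. pat y = pat x}"
    have "{y\<in>W. pat y = pat x} =
        C \<inter> (\<Inter>i\<in>I. if i \<in> pat x then {y. a i \<bullet> y > b i} else {y. a i \<bullet> y < b i})"
      (is "?W = ?H")
    proof (intro set_eqI)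
      fix y
      have "y \<in> ?W \<longleftrightarrow> y \<in> C \<and> (\<forall>i\<in>I. h i y \<noteq> 0 \<and> (h i y > 0 \<longleftrightarrow> i \<in> pat x))"
        by (auto simp: W_def pat_def)
      also have "\<dots> \<longleftrightarrow> y \<in> C \<and> (\<forall>i\<in>I. if i \<in> pat x then h i y > 0 else h i y < 0)"
        by (intro conj_cong refl ball_cong) auto
      also have "\<dots> \<longleftrightarrow> y \<in> ?H"
        by (auto simp: h)
      finally show "y \<in> ?W \<longleftrightarrow> y \<in> ?H" .
    qed
    also have "convex \<dots>"
      using C by (intro convex_Int convex_INT) (auto simp: convex_halfspace_lt convex_halfspace_gt)
    finally show "y \<in> connected_component_set W x"
      using y \<open>x \<in> W\<close> convex_connected by (auto simp: connected_component_def)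
  qed
  have "components W = (\<lambda>X. {y\<in>W. pat y = X}) ` (pat ` W)"
    using cc by (force simp: components_def image_image)
  moreover have "inj_on (\<lambda>X. {y\<in>W. pat y = X}) (pat ` W)"
    by (intro inj_onI) blast
  ultimately have "card (components W) = card (pat ` W)" by (simp add: card_image)
  then show ?thesis by (simp add: W_def sign_patterns_def pat_def[abs_def])
qed

subsection \<open>Subsets meeting the members of a family in few points\<close>

lemma card_subsets_inter:
  assumes T: "finite T" and S: "S \<subseteq> T" and ik: "i \<le> k"
  shows "card {X. X \<subseteq> T \<and> card X = k \<and> card (X \<inter> S) = i} =
    (card S choose i) * (card T - card S choose (k - i))"
proof -
  define P where "P = {Y. Y \<subseteq> S \<and> card Y = i}"
  define Q where "Q = {Z. Z \<subseteq> T - S \<and> card Z = k - i}"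
  have fin: "finite S" "finite (T - S)" using T S finite_subset by auto
  have "bij_betw (\<lambda>(Y, Z). Y \<union> Z) (P \<times> Q) {X. X \<subseteq> T \<and> card X = k \<and> card (X \<inter> S) = i}"
  proof (rule bij_betw_byWitness[where f' = "\<lambda>X. (X \<inter> S, X - S)"])
    show "(\<lambda>(Y, Z). Y \<union> Z) ` (P \<times> Q) \<subseteq> {X. X \<subseteq> T \<and> card X = k \<and> card (X \<inter> S) = i}"
    proof clarify
      fix Y Z assume "Y \<in> P" "Z \<in> Q"
      then have YZ: "Y \<subseteq> S" "card Y = i" "Z \<subseteq> T - S" "card Z = k - i"
        by (auto simp: P_def Q_def)
      have "(Y \<union> Z) \<inter> S = Y" using YZ by blast
      moreover have "card (Y \<union> Z) = card Y + card Z"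
        using YZ fin by (intro card_Un_disjoint) (auto intro: finite_subset)
      ultimately show "Y \<union> Z \<subseteq> T \<and> card (Y \<union> Z) = k \<and> card ((Y \<union> Z) \<inter> S) = i"
        using YZ S ik by auto
    qed
    show "(\<lambda>X. (X \<inter> S, X - S)) ` {X. X \<subseteq> T \<and> card X = k \<and> card (X \<inter> S) = i} \<subseteq> P \<times> Q"
    proof clarify
      fix X assume X: "X \<subseteq> T" "k = card X" "i = card (X \<inter> S)"
      have "card (X - S) = card X - card (X \<inter> S)"
        using finite_subset[OF X(1) T] by (simp add: card_Diff_subset_Int)
      then show "X \<inter> S \<in> P \<and> X - S \<in> Q"
        using X by (auto simp: P_def Q_def)
    qed
  qed (auto simp: P_def Q_def)
  then have "card {X. X \<subseteq> T \<and> card X = k \<and> card (X \<inter> S) = i} = card P * card Q"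
    by (simp add: bij_betw_same_card[symmetric] card_cartesian_product)
  also have "card P = card S choose i" unfolding P_def using fin by (simp add: n_subsets)
  also have "card Q = card T - card S choose (k - i)"
    unfolding Q_def using fin S by (simp add: n_subsets card_Diff_subset)
  finally show ?thesis .
qed

lemma card_subsets_inter_ge:
  assumes T: "finite T" and S: "S \<subseteq> T"
  shows "card {X. X \<subseteq> T \<and> card X = k \<and> card (X \<inter> S) \<ge> j} =
    (\<Sum>i=j..k. (card S choose i) * (card T - card S choose (k - i)))"
proof -
  have "{X. X \<subseteq> T \<and> card X = k \<and> card (X \<inter> S) \<ge> j} =
      (\<Union>i\<in>{j..k}. {X. X \<subseteq> T \<and> card X = k \<and> card (X \<inter> S) = i})" (is "?L = ?R")
  proof (intro equalityI subsetI)
    fix X assume X: "X \<in> ?L"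
    then have "card (X \<inter> S) \<le> k" using card_mono[of X "X \<inter> S"] T finite_subset by fastforce
    then show "X \<in> ?R" using X by auto
  qed auto
  also have "card \<dots> = (\<Sum>i=j..k. card {X. X \<subseteq> T \<and> card X = k \<and> card (X \<inter> S) = i})"
    using T by (intro card_UN_disjoint) auto
  also have "\<dots> = (\<Sum>i=j..k. (card S choose i) * (card T - card S choose (k - i)))"
    by (intro sum.cong refl card_subsets_inter[OF T S]) simp
  finally show ?thesis .
qed

text \<open>Two members of the family, each with \<open>j\<close> points of \<open>X\<close>, would
  force \<open>2 * j - 1\<close> points into \<open>X\<close>, more than \<open>k\<close>. The bad
  sets for different \<open>r\<close> are therefore disjoint and their numbers simply add up. The
  additive form avoids subtraction of natural numbers.\<close>

lemma card_subsets_inter_less: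
  fixes S :: "'r::finite \<Rightarrow> 'a set"
  assumes T: "finite T" and S: "\<And>r. S r \<subseteq> T" and j: "k + 1 < 2 * j"
    and SS: "\<And>r r'. r \<noteq> r' \<Longrightarrow> card (S r \<inter> S r') \<le> 1"
  shows "card {X. X \<subseteq> T \<and> card X = k \<and> (\<forall>r. card (X \<inter> S r) < j)} +
    (\<Sum>r\<in>UNIV. \<Sum>i=j..k. (card (S r) choose i) * (card T - card (S r) choose (k - i))) = card T choose k"
proof -
  define B where "B r = {X. X \<subseteq> T \<and> card X = k \<and> card (X \<inter> S r) \<ge> j}" for r
  have disj: "B r \<inter> B r' = {}" if "r \<noteq> r'" for r r'
  proof (rule ccontr)
    assume "B r \<inter> B r' \<noteq> {}"
    then obtain X where X: "X \<subseteq> T" "card X = k" "card (X \<inter> S r) \<ge> j" "card (X \<inter> S r') \<ge> j"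
      by (auto simp: B_def)
    have f: "finite X" "finite (S r)" using X(1) S T finite_subset by blast+
    have "card (X \<inter> S r) + card (X \<inter> S r') =
        card (X \<inter> S r \<union> X \<inter> S r') + card (X \<inter> S r \<inter> (X \<inter> S r'))"
      using f by (intro card_Un_Int) auto
    moreover have "card (X \<inter> S r \<union> X \<inter> S r') \<le> card X" using f by (intro card_mono) auto
    moreover have "card (X \<inter> S r \<inter> (X \<inter> S r')) \<le> card (S r \<inter> S r')"
      using f by (intro card_mono) auto
    moreover note SS[OF that]
    ultimately show False using X j by linarith
  qed
  have "card (\<Union>r. B r) = (\<Sum>r\<in>UNIV. card (B r))"
    using T disj by (intro card_UN_disjoint) (auto simp: B_def)
  also have "\<dots> = (\<Sum>r\<in>UNIV. \<Sum>i=j..k. (card (S r) choose i) * (card T - card (S r) choose (k - i)))"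
    unfolding B_def by (intro sum.cong refl card_subsets_inter_ge[OF T S])
  finally have 1: "card (\<Union>r. B r) = \<dots>" .
  have "{X. X \<subseteq> T \<and> card X = k} =
      {X. X \<subseteq> T \<and> card X = k \<and> (\<forall>r. card (X \<inter> S r) < j)} \<union> (\<Union>r. B r)"
    by (auto simp: B_def not_less)
  then have "card T choose k = card ({X. X \<subseteq> T \<and> card X = k \<and> (\<forall>r. card (X \<inter> S r) < j)} \<union> (\<Union>r. B r))"
    using n_subsets[OF T, of k] by simp
  also have "\<dots> = card {X. X \<subseteq> T \<and> card X = k \<and> (\<forall>r. card (X \<inter> S r) < j)} + card (\<Union>r. B r)"
    using T by (intro card_Un_disjoint) (auto simp: B_def not_less[symmetric])
  finally show ?thesis using 1 by simp
qed

section \<open>Increasing tuples and binomial polynomials\<close>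

lemma card_2_subsets_linorder:
  fixes T :: "'a::linorder set"
  shows "card {(a, b). a \<in> T \<and> b \<in> T \<and> a < b \<and> P {a, b}} =
    card {X. X \<subseteq> T \<and> card X = 2 \<and> P X}"
proof (rule bij_betw_same_card[of "\<lambda>(a, b). {a, b}"], rule bij_betw_imageI)
  show "inj_on (\<lambda>(a, b). {a, b}) {(a, b). a \<in> T \<and> b \<in> T \<and> a < b \<and> P {a, b}}"
    by (auto simp: inj_on_def doubleton_eq_iff)
  show "(\<lambda>(a, b). {a, b}) ` {(a, b). a \<in> T \<and> b \<in> T \<and> a < b \<and> P {a, b}} =
      {X. X \<subseteq> T \<and> card X = 2 \<and> P X}" (is "?f ` ?A = ?B")
  proof (intro equalityI subsetI)
    fix X assume "X \<in> ?B"
    then obtain a b where "X = {a, b}" "a \<noteq> b" "X \<subseteq> T" "P X" by (auto simp: card_2_iff)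
    then show "X \<in> ?f ` ?A"
      by (cases "a < b") (force simp: insert_commute)+
  qed auto
qed

text \<open>A four-element set has one increasing listing, and pairing its first with its third and
  its second with its fourth element is the only way to split it into interleaved pairs. This is the
  shape in which \<open>crossings\<close> lists two chords.\<close>

lemma card_4_subsets_linorder:
  fixes T :: "'a::linorder set"
  shows "card {((a, c), (b, d)). a \<in> T \<and> b \<in> T \<and> c \<in> T \<and> d \<in> T \<and> a < b \<and> b < c \<and> c < d \<and> P {a, b, c, d}} =
    card {X. X \<subseteq> T \<and> card X = 4 \<and> P X}"
proof (rule bij_betw_same_card[of "\<lambda>((a, c), (b, d)). {a, b, c, d}"], rule bij_betw_imageI)
  have sorted: "sorted_list_of_set {a, b, c, d} = [a, b, c, d]" if "a < b" "b < c" "c < d" for a b c d :: 'a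
  proof -
    have "sorted_list_of_set (set [a, b, c, d]) = [a, b, c, d]"
      using that by (intro sorted_list_of_set.idem_if_sorted_distinct) auto
    then show ?thesis by (simp only: list.set)
  qed
  show "inj_on (\<lambda>((a, c), (b, d)). {a, b, c, d})
      {((a, c), (b, d)). a \<in> T \<and> b \<in> T \<and> c \<in> T \<and> d \<in> T \<and> a < b \<and> b < c \<and> c < d \<and> P {a, b, c, d}}"
    (is "inj_on ?f ?A")
  proof (rule inj_onI)
    fix x y assume "x \<in> ?A" "y \<in> ?A" "?f x = ?f y"
    then obtain a b c d a' b' c' d' where
      xy: "x = ((a, c), (b, d))" "y = ((a', c'), (b', d'))" "{a, b, c, d} = {a', b', c', d'}"
      and less: "a < b" "b < c" "c < d" "a' < b'" "b' < c'" "c' < d'" by auto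
    have "sorted_list_of_set {a, b, c, d} = sorted_list_of_set {a', b', c', d'}"
      using xy(3) by (rule arg_cong)
    then have "[a, b, c, d] = [a', b', c', d']"
      unfolding sorted[OF less(1-3)] sorted[OF less(4-6)] .
    then show "x = y" using xy by simp
  qed
  show "(\<lambda>((a, c), (b, d)). {a, b, c, d}) `
      {((a, c), (b, d)). a \<in> T \<and> b \<in> T \<and> c \<in> T \<and> d \<in> T \<and> a < b \<and> b < c \<and> c < d \<and> P {a, b, c, d}} =
      {X. X \<subseteq> T \<and> card X = 4 \<and> P X}" (is "?f ` ?A = ?B")
  proof (intro equalityI subsetI)
    fix X assume X: "X \<in> ?B"
    then have fin: "finite X" using card_ge_0_finite[of X] by simp
    have "\<exists>a b c d. xs = [a, b, c, d]" if "length xs = 4" for xs :: "'a list"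
      using that by (auto simp: numeral_eq_Suc length_Suc_conv)
    moreover have "length (sorted_list_of_set X) = 4" using X by simp
    ultimately obtain a b c d where abcd: "sorted_list_of_set X = [a, b, c, d]" by blast
    then have "X = {a, b, c, d}" using set_sorted_list_of_set[OF fin] by simp
    moreover have "a < b" "b < c" "c < d"
      using strict_sorted_list_of_set[of X] unfolding abcd by auto
    ultimately have "((a, c), (b, d)) \<in> ?A" "X = ?f ((a, c), (b, d))" using X by simp_all
    then show "X \<in> ?f ` ?A" by blast
  next
    fix X assume "X \<in> ?f ` ?A"
    then obtain a b c d where "X = {a, b, c, d}" "X \<subseteq> T" "P X" "a < b" "b < c" "c < d" by auto
    moreover from this have "a \<notin> {b, c, d}" "b \<notin> {c, d}" "c \<notin> {d}" by auto
    then have "card {a, b, c, d} = 4" by simp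
    ultimately show "X \<in> ?B" by blast
  qed
qed

text \<open>The polynomials also hold below the lower index, where a factor vanishes, so small
  \<open>m\<close> and \<open>n\<close> need no cases of their own.\<close>

lemma real_choose_2: "real (n choose 2) = real n * (real n - 1) / 2"
  by (simp add: binomial_gbinomial gbinomial_prod_rev numeral_eq_Suc)

lemma real_choose_3: "real (n choose 3) = real n * (real n - 1) * (real n - 2) / 6"
  by (simp add: binomial_gbinomial gbinomial_prod_rev numeral_eq_Suc field_simps)

lemma real_choose_4: "real (n choose 4) = real n * (real n - 1) * (real n - 2) * (real n - 3) / 24"
  by (simp add: binomial_gbinomial gbinomial_prod_rev numeral_eq_Suc field_simps)

subsection \<open>The boundary of the rectangle\<close>

text \<open>
  \<open>perim m n t\<close> is the boundary point at distance \<open>t\<close> counterclockwise from the origin. The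
  origin has the parameter \<open>0\<close> only, which therefore counts as a parameter of both \<open>South\<close> and
  \<open>West\<close>.
\<close>

definition perim :: "nat \<Rightarrow> nat \<Rightarrow> real \<Rightarrow> real \<times> real" where
  "perim m n t =
    (if t \<le> real n then (t, 0)
     else if t \<le> real n + real m then (real n, t - real n)
     else if t \<le> 2 * real n + real m then (2 * real n + real m - t, real m)
     else (0, 2 * real n + 2 * real m - t))"

text \<open>The full line carrying the side; within the rectangle it cuts out the side
  itself.\<close>

fun side_line :: "nat \<Rightarrow> nat \<Rightarrow> side \<Rightarrow> (real \<times> real) set" where
  "side_line m n West = {p. fst p = 0}"
| "side_line m n East = {p. fst p = real n}"
| "side_line m n South = {p. snd p = 0}"
| "side_line m n North = {p. snd p = real m}"

fun side_params :: "nat \<Rightarrow> nat \<Rightarrow> side \<Rightarrow> real set" where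
  "side_params m n South = {0..real n}"
| "side_params m n East = {real n..real n + real m}"
| "side_params m n North = {real n + real m..2 * real n + real m}"
| "side_params m n West = insert 0 {2 * real n + real m..<2 * real n + 2 * real m}"

lemma perim_side_line_iff:
  assumes "m \<ge> 1" "n \<ge> 1" "0 \<le> t" "t < 2 * real n + 2 * real m"
  shows "perim m n t \<in> side_line m n s \<longleftrightarrow> t \<in> side_params m n s"
  using assms by (cases s) (auto simp: perim_def)

text \<open>Twice the signed area of the triangle \<open>p q x\<close>, positive for a
  counterclockwise triangle.\<close>

definition orient :: "real \<times> real \<Rightarrow> real \<times> real \<Rightarrow> real \<times> real \<Rightarrow> real" where
  "orient p q x = (fst q - fst p) * (snd x - snd p) - (snd q - snd p) * (fst x - fst p)"

lemma inj_on_perim: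
  assumes "m \<ge> 1" "n \<ge> 1"
  shows "inj_on (perim m n) {0..<2 * real n + 2 * real m}"
  using assms by (intro inj_onI) (auto simp: perim_def split: if_splits)

lemma perim_image:
  assumes "m \<ge> 1" "n \<ge> 1"
  shows "perim m n ` {0..<2 * real n + 2 * real m} = rectangle m n \<inter> (\<Union>s. side_line m n s)"
    (is "?P = ?B")
proof (intro equalityI subsetI)
  fix p assume "p \<in> ?P"
  then obtain t where t: "p = perim m n t" "0 \<le> t" "t < 2 * real n + 2 * real m" by auto
  have "t \<in> (\<Union>s. side_params m n s)"
    using t(2,3) side_params.simps by (metis (mono_tags, lifting) UN_iff UNIV_I atLeastAtMost_iff atLeastLessThan_iff insertCI linorder_le_cases)
  then have "p \<in> (\<Union>s. side_line m n s)" using perim_side_line_iff[OF assms] t by auto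
  moreover have "p \<in> rectangle m n" using t by (auto simp: rectangle_def perim_def split: if_splits)
  ultimately show "p \<in> ?B" by blast
next
  fix p assume "p \<in> ?B"
  then obtain s where p: "p \<in> side_line m n s" "0 \<le> fst p" "fst p \<le> real n" "0 \<le> snd p" "snd p \<le> real m"
    by (cases p) (auto simp: rectangle_def)
  obtain x y where xy: "p = (x, y)" by (cases p)
  consider "y = 0" | "x = real n" "y \<noteq> 0" | "y = real m" "y \<noteq> 0" "x \<noteq> real n" | "x = 0" "y \<noteq> 0" "y \<noteq> real m"
    using p assms xy by (cases s) auto
  then show "p \<in> ?P"
  proof cases
    case 1
    then have "p = perim m n x" "x \<in> {0..<2 * real n + 2 * real m}"
      using xy p assms by (auto simp: perim_def)
    then show ?thesis by blast
  next
    case 2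
    then have "p = perim m n (real n + y)" "real n + y \<in> {0..<2 * real n + 2 * real m}"
      using xy p assms by (auto simp: perim_def)
    then show ?thesis by blast
  next
    case 3
    then have "p = perim m n (2 * real n + real m - x)" "2 * real n + real m - x \<in> {0..<2 * real n + 2 * real m}"
      using xy p assms by (auto simp: perim_def)
    then show ?thesis by blast
  next
    case 4
    then have "p = perim m n (2 * real n + 2 * real m - y)" "2 * real n + 2 * real m - y \<in> {0..<2 * real n + 2 * real m}"
      using xy p assms by (auto simp: perim_def)
    then show ?thesis by blast
  qed
qed

text \<open>Three points met in counterclockwise order on a convex curve span a counterclockwise
  triangle unless they are collinear, which here requires a common side. Once the sides are fixed,
  the area is mostly an explicit sum of products of nonnegative lengths, and \<open>ns\<close> makes
  some product positive. All sign information about chords comes from this lemma.\<close>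

lemma orient_perim_pos:
  assumes "m \<ge> 1" "n \<ge> 1" and "0 \<le> s" "s < t" "t < u" "u < 2 * real n + 2 * real m"
    and ns: "\<not> (\<exists>r. s \<in> side_params m n r \<and> t \<in> side_params m n r \<and> u \<in> side_params m n r)"
  shows "orient (perim m n s) (perim m n t) (perim m n u) > 0"
proof -
  define A B where "A = real n" and "B = real m"
  have AB: "A > 0" "B > 0" using assms by (auto simp: A_def B_def)
  \<comment> \<open>For increasing parameters a common side is decided by the extreme ones; on West
    the first may also be the origin, with parameter 0.\<close>
  have ns': "\<not> (u \<le> A)" "\<not> (A \<le> s \<and> u \<le> A + B)" "\<not> (A + B \<le> s \<and> u \<le> 2*A+B)"
    "\<not> ((s = 0 \<or> 2*A+B \<le> s) \<and> 2 * A + B \<le> t)"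
    using ns assms(3-6) unfolding A_def B_def
    by (auto dest: spec[of _ South] spec[of _ East] spec[of _ North] spec[of _ West])
  note d = perim_def orient_def A_def[symmetric] B_def[symmetric]
  have o: "0 \<le> s" "s < t" "t < u" "u < 2*A + 2*B" using assms by (auto simp: A_def B_def)
  \<comment> \<open>The letters name the sides of \<open>s\<close> and \<open>t\<close>. Half-open
    ranges assign each corner to a single case; \<open>u\<close> is split further where its formula
    matters.\<close>
  consider (SS) "t \<le> A" | (SE) "s \<le> A" "A < t" "t \<le> A + B"
    | (SN) "s \<le> A" "A + B < t" "t \<le> 2*A+B" | (SW) "s \<le> A" "2*A+B < t"
    | (EE) "A < s" "t \<le> A+B" | (EN) "A < s" "s \<le> A+B" "A+B < t" "t \<le> 2*A+B"
    | (EW) "A < s" "s \<le> A+B" "2*A+B < t"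
    | (NN) "A+B < s" "t \<le> 2*A+B" | (NW) "A+B < s" "s \<le> 2*A+B" "2*A+B < t" | (WW) "2*A+B < s"
    by linarith
  then show ?thesis
  proof cases
    case SS
    have "snd (perim m n u) > 0" using ns' o AB by (auto simp: d)
    moreover have "perim m n s = (s,0)" "perim m n t = (t,0)" using SS o by (auto simp: d)
    ultimately show ?thesis using o by (simp add: orient_def)
  next
    case SE
    have pq: "perim m n s = (s,0)" "perim m n t = (A, t-A)" using SE o by (auto simp: d)
    consider "u \<le> A+B" | "A+B < u" "u \<le> 2*A+B" | "2*A+B < u" by linarith
    then show ?thesis
    proof cases
      case 1
      have "orient (perim m n s) (perim m n t) (perim m n u) = (A - s) * (u - t)"
        using 1 SE o by (simp add: d pq algebra_simps)
      moreover have "s < A" using ns' 1 by linarith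
      ultimately show ?thesis using o by simp
    next
      case 2
      have "orient (perim m n s) (perim m n t) (perim m n u) = (A - s) * (A+B-t) + (t-A)*(u-A-B)"
        using 2 SE o AB by (simp add: d pq algebra_simps)
      then show ?thesis using 2 SE by (simp add: add_nonneg_pos)
    next
      case 3
      have e: "orient (perim m n s) (perim m n t) (perim m n u) = (A - s) * (2*A+2*B-u) + (t-A) * s"
        using 3 SE o AB by (simp add: d pq algebra_simps)
      show ?thesis
      proof (cases "s = A")
        case True then show ?thesis using e SE AB by simp
      next
        case False then show ?thesis unfolding e using SE o by (intro add_pos_nonneg) auto
      qed
    qed
  next
    case SN
    have pq: "perim m n s = (s,0)" "perim m n t = (2*A+B-t, B)" using SN o AB by (auto simp: d)
    consider "u \<le> 2*A+B" | "2*A+B < u" by linarith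
    then show ?thesis
    proof cases
      case 1
      have "orient (perim m n s) (perim m n t) (perim m n u) = B * (u - t)"
        using 1 SN o AB by (simp add: d pq algebra_simps)
      then show ?thesis using o AB by simp
    next
      case 2
      have e: "orient (perim m n s) (perim m n t) (perim m n u) = (2*A+B-t) * (2*A+2*B-u) + s * (u-2*A-B)"
        using 2 SN o AB by (simp add: d pq algebra_simps)
      show ?thesis
      proof (cases "s = 0")
        case True then have "t < 2*A+B" using ns' by linarith
        then show ?thesis using e SN o True by simp
      next
        case False then show ?thesis unfolding e using SN o 2 by (intro add_nonneg_pos) auto
      qed
    qed
  next
    case SW
    have "orient (perim m n s) (perim m n t) (perim m n u) = s * (u - t)"
      using SW o AB by (simp add: d algebra_simps)
    moreover have "s \<noteq> 0" using ns' SW by linarith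
    ultimately show ?thesis using o by simp
  next
    case EE
    have "fst (perim m n u) < A" using ns' o AB EE by (auto simp: d)
    moreover have "perim m n s = (A,s-A)" "perim m n t = (A,t-A)" using EE o by (auto simp: d)
    ultimately show ?thesis using o by (simp add: orient_def mult_pos_neg)
  next
    case EN
    have pq: "perim m n s = (A,s-A)" "perim m n t = (2*A+B-t, B)" using EN o AB by (auto simp: d)
    consider "u \<le> 2*A+B" | "2*A+B < u" by linarith
    then show ?thesis
    proof cases
      case 1
      have "orient (perim m n s) (perim m n t) (perim m n u) = (A + B - s) * (u - t)"
        using 1 EN o AB by (simp add: d pq algebra_simps)
      moreover have "s < A+B" using ns' 1 by linarith
      ultimately show ?thesis using o AB by simp
    next
      case 2
      have "orient (perim m n s) (perim m n t) (perim m n u) = (t-A-B) * (u-2*A-B) + (2*A+B-t)*(A+B-s)"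
        using 2 EN o AB by (simp add: d pq algebra_simps)
      then show ?thesis using EN o 2 by (simp add: add_pos_nonneg)
    qed
  next
    case EW
    have "orient (perim m n s) (perim m n t) (perim m n u) = A * (u - t)"
      using EW o AB by (simp add: d algebra_simps)
    then show ?thesis using o AB by simp
  next
    case NN
    have "snd (perim m n u) < B" using ns' o AB NN by (auto simp: d)
    moreover have "perim m n s = (2*A+B-s,B)" "perim m n t = (2*A+B-t,B)" using NN o AB by (auto simp: d)
    ultimately show ?thesis using o by (simp add: orient_def mult_neg_neg)
  next
    case NW
    have "orient (perim m n s) (perim m n t) (perim m n u) = (2*A+B-s) * (u - t)"
      using NW o AB by (simp add: d algebra_simps)
    moreover have "s < 2*A+B" using ns' NW by linarith
    ultimately show ?thesis using o AB by simp
  next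
    case WW
    then show ?thesis using ns' o by linarith
  qed
qed

section \<open>Boundary nodes, in all and on each side\<close>

lemma UNIV_side: "(UNIV :: side set) = {West, East, South, North}"
proof (intro equalityI subsetI)
  fix s show "s \<in> {West, East, South, North}" by (cases s) auto
qed simp

text \<open>The sides index the family to which \<open>card_subsets_inter_less\<close> is applied,
  and that lemma sums over a finite type.\<close>

instance side :: finite
proof
  show "finite (UNIV :: side set)" unfolding UNIV_side by simp
qed

text \<open>Here "inner" means inner to the side, not to the rectangle. Without the corners the four
  sets are disjoint.\<close>

definition inner_nodes :: "nat \<Rightarrow> nat \<Rightarrow> perturbation \<Rightarrow> side \<Rightarrow> (real \<times> real) set" where
  "inner_nodes m n \<delta> s = (\<lambda>i. side_point m n s (node_pos \<delta> s i)) ` {1..<side_length m n s}"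

lemma boundary_nodes_eq: "boundary_nodes m n \<delta> = corners m n \<union> (\<Union>s. inner_nodes m n \<delta> s)"
proof -
  have "i \<in> {1..<side_length m n s} \<longleftrightarrow> 0 < i \<and> i < side_length m n s" for i s
    by auto
  then show ?thesis
    unfolding boundary_nodes_def inner_nodes_def by blast
qed

locale bc_graph =
  fixes m n :: nat and \<delta> :: perturbation
  assumes m_pos: "m \<ge> 1" and n_pos: "n \<ge> 1" and admissible: "admissible m n \<delta>"
begin

lemma admissibleD:
  assumes "i \<in> {1..<side_length m n s}"
  shows "0 < node_pos \<delta> s i" "node_pos \<delta> s i < real (side_length m n s)"
  using assms admissible by (auto simp: admissible_def)

text \<open>A division node stays strictly between the ends of its side, and only the ends lie on a
  second side.\<close>

lemma inner_nodes_side_line_iff: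
  assumes "p \<in> inner_nodes m n \<delta> s"
  shows "p \<in> side_line m n r \<longleftrightarrow> r = s"
proof -
  obtain i where i: "i \<in> {1..<side_length m n s}" "p = side_point m n s (node_pos \<delta> s i)"
    using assms by (auto simp: inner_nodes_def)
  then show ?thesis using admissibleD[OF i(1)] m_pos n_pos by (cases s; cases r) auto
qed

lemma boundary_nodes_subset: "boundary_nodes m n \<delta> \<subseteq> rectangle m n \<inter> (\<Union>s. side_line m n s)"
proof
  fix p assume "p \<in> boundary_nodes m n \<delta>"
  then consider "p \<in> corners m n" | s where "p \<in> inner_nodes m n \<delta> s"
    by (auto simp: boundary_nodes_eq)
  then show "p \<in> rectangle m n \<inter> (\<Union>s. side_line m n s)"
  proof cases
    case 1
    then have "p \<in> side_line m n West \<union> side_line m n East" "p \<in> rectangle m n"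
      by (auto simp: corners_def rectangle_def)
    then show ?thesis by blast
  next
    case 2
    then obtain i where i: "i \<in> {1..<side_length m n s}" "p = side_point m n s (node_pos \<delta> s i)"
      by (auto simp: inner_nodes_def)
    then have "p \<in> rectangle m n"
      using admissibleD[OF i(1)] by (cases s) (auto simp: rectangle_def)
    then show ?thesis using inner_nodes_side_line_iff[OF 2] by blast
  qed
qed

lemma card_inner_nodes: "card (inner_nodes m n \<delta> s) = side_length m n s - 1"
proof -
  have "strict_mono_on {1..<side_length m n s} (node_pos \<delta> s)"
    using admissible by (intro strict_mono_onI) (simp add: admissible_def)
  then have "inj_on (node_pos \<delta> s) {1..<side_length m n s}"
    by (rule strict_mono_on_imp_inj_on)
  moreover have "inj (side_point m n s)" by (cases s) (auto simp: inj_def)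
  ultimately have "inj_on (\<lambda>i. side_point m n s (node_pos \<delta> s i)) {1..<side_length m n s}"
    by (auto simp: inj_on_def)
  then show ?thesis by (simp add: inner_nodes_def card_image)
qed

lemma finite_inner_nodes: "finite (inner_nodes m n \<delta> s)"
  by (simp add: inner_nodes_def)

lemma finite_corners: "finite (corners m n)"
  by (simp add: corners_def)

lemma corners_inner_nodes_disjoint: "corners m n \<inter> inner_nodes m n \<delta> s = {}"
proof (rule ccontr)
  assume "corners m n \<inter> inner_nodes m n \<delta> s \<noteq> {}"
  then obtain p where p: "p \<in> corners m n" "p \<in> inner_nodes m n \<delta> s" by blast
  have "p \<in> side_line m n West \<union> side_line m n East" "p \<in> side_line m n South \<union> side_line m n North"
    using p(1) by (auto simp: corners_def)
  then have "s \<in> {West, East} \<and> s \<in> {South, North}"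
    unfolding Un_iff inner_nodes_side_line_iff[OF p(2)] by blast
  then show False by auto
qed

lemma card_boundary_nodes: "card (boundary_nodes m n \<delta>) = 2 * m + 2 * n"
proof -
  have "card (\<Union>s. inner_nodes m n \<delta> s) = (\<Sum>s\<in>UNIV. card (inner_nodes m n \<delta> s))"
  proof (rule card_UN_disjoint)
    show "\<forall>s\<in>UNIV. \<forall>r\<in>UNIV. s \<noteq> r \<longrightarrow> inner_nodes m n \<delta> s \<inter> inner_nodes m n \<delta> r = {}"
      using inner_nodes_side_line_iff by blast
  qed (auto simp: finite_inner_nodes)
  also have "\<dots> = 2 * (m - 1) + 2 * (n - 1)"
    by (simp add: UNIV_side card_inner_nodes)
  finally have "card (\<Union>s. inner_nodes m n \<delta> s) = 2 * (m - 1) + 2 * (n - 1)" .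
  moreover have "card (corners m n) = 4"
    using m_pos n_pos by (simp add: corners_def card_cartesian_product)
  moreover have "card (boundary_nodes m n \<delta>) = card (corners m n) + card (\<Union>s. inner_nodes m n \<delta> s)"
    unfolding boundary_nodes_eq using corners_inner_nodes_disjoint
    by (intro card_Un_disjoint) (auto simp: finite_inner_nodes finite_corners)
  ultimately show ?thesis using m_pos n_pos by simp
qed

text \<open>Two corners join the \<open>side_length m n s - 1\<close> division nodes; each corner is
  thus counted on both of its sides.\<close>

lemma card_boundary_nodes_side_line:
  "card (boundary_nodes m n \<delta> \<inter> side_line m n s) = side_length m n s + 1"
proof -
  have "boundary_nodes m n \<delta> \<inter> side_line m n s = (corners m n \<inter> side_line m n s) \<union> inner_nodes m n \<delta> s"
    using inner_nodes_side_line_iff by (auto simp: boundary_nodes_eq)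
  moreover have "corners m n \<inter> side_line m n s =
      (case s of West \<Rightarrow> {(0, 0), (0, real m)} | East \<Rightarrow> {(real n, 0), (real n, real m)}
       | South \<Rightarrow> {(0, 0), (real n, 0)} | North \<Rightarrow> {(0, real m), (real n, real m)})"
    using m_pos n_pos by (cases s) (auto simp: corners_def)
  then have "card (corners m n \<inter> side_line m n s) = 2"
    using m_pos n_pos by (cases s) auto
  moreover have "card ((corners m n \<inter> side_line m n s) \<union> inner_nodes m n \<delta> s) =
      card (corners m n \<inter> side_line m n s) + card (inner_nodes m n \<delta> s)"
    using corners_inner_nodes_disjoint finite_corners
    by (intro card_Un_disjoint) (auto simp: finite_inner_nodes)
  moreover have "side_length m n s \<ge> 1" using m_pos n_pos by (cases s) auto
  ultimately show ?thesis by (simp add: card_inner_nodes)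
qed

end

section \<open>Segments and lines in the rectangle, and edges of the graph\<close>

lemma interior_rectangle:
  "interior (rectangle m n) = {p. 0 < fst p \<and> fst p < real n \<and> 0 < snd p \<and> snd p < real m}"
  unfolding rectangle_def cbox_Pair_eq interior_Times box_real interior_atLeastAtMost_real by auto

lemma mem_rectangle: "(x, y) \<in> rectangle m n \<longleftrightarrow> 0 \<le> x \<and> x \<le> real n \<and> 0 \<le> y \<and> y \<le> real m"
  by (auto simp: rectangle_def)

lemma interior_rectangle_iff:
  "p \<in> interior (rectangle m n) \<longleftrightarrow> p \<in> rectangle m n \<and> (\<forall>s. p \<notin> side_line m n s)"
proof -
  have "(\<forall>s. p \<notin> side_line m n s) \<longleftrightarrow> fst p \<noteq> 0 \<and> fst p \<noteq> real n \<and> snd p \<noteq> 0 \<and> snd p \<noteq> real m"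
    using UNIV_side by (metis (mono_tags) side_line.simps mem_Collect_eq side.exhaust)
  then show ?thesis by (cases p) (auto simp: interior_rectangle mem_rectangle)
qed

text \<open>A strict convex combination attains the bound of a coordinate only if both ends attain
  it, that is, if they share a side.\<close>

lemma segment_interior_rectangle:
  assumes "p \<in> rectangle m n" "q \<in> rectangle m n" "\<And>s. \<not> (p \<in> side_line m n s \<and> q \<in> side_line m n s)"
    and u: "0 < u" "u < 1"
  shows "(1 - u) *\<^sub>R p + u *\<^sub>R q \<in> interior (rectangle m n)"
proof -
  have pos: "(1 - u) * x + u * y > 0" if "x \<ge> 0" "y \<ge> 0" "\<not> (x = 0 \<and> y = 0)" for x y :: real
    using that u by (cases "x = 0") (auto intro: add_pos_nonneg)
  have lt: "(1 - u) * x + u * y < z" if "x \<le> z" "y \<le> z" "\<not> (x = z \<and> y = z)" for x y z :: real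
    using pos[of "z - x" "z - y"] that by (auto simp: algebra_simps)
  obtain a b c d where pq: "p = (a, b)" "q = (c, d)" by (cases p; cases q)
  have "0 < (1 - u) * a + u * c" "(1 - u) * a + u * c < real n"
    "0 < (1 - u) * b + u * d" "(1 - u) * b + u * d < real m"
    using assms(1,2) assms(3)[of West] assms(3)[of East] assms(3)[of South] assms(3)[of North]
    unfolding pq mem_rectangle by (auto intro!: pos lt simp del: de_Morgan_conj)
  then show ?thesis by (simp add: interior_rectangle pq)
qed

text \<open>The vector \<open>q - p\<close> turned by a right angle; it is the gradient of
  \<open>orient p q\<close>, which thereby takes the form \<open>a i \<bullet> x - b i\<close> of
  the arrangement lemmas.\<close>

definition normal :: "real \<times> real \<Rightarrow> real \<times> real \<Rightarrow> real \<times> real" where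
  "normal p q = (snd p - snd q, fst q - fst p)"

lemma orient_eq_normal: "orient p q x = normal p q \<bullet> x - normal p q \<bullet> p"
  by (simp add: orient_def normal_def inner_prod_def algebra_simps)

lemma orient_cyclic: "orient q r p = orient p q r"
  by (simp add: orient_def algebra_simps)

lemma orient_swap: "orient p r q = - orient p q r"
  by (simp add: orient_def algebra_simps)

lemma orient_convex_comb: "orient p q ((1 - u) *\<^sub>R x + u *\<^sub>R y) = (1 - u) * orient p q x + u * orient p q y"
  by (simp add: orient_def algebra_simps)

lemma orient_eq_0_imp_on_line:
  assumes "orient p q x = 0" "p \<noteq> q"
  obtains u where "x = (1 - u) *\<^sub>R p + u *\<^sub>R q"
proof (cases "fst p = fst q")
  case False
  define u where "u = (fst x - fst p) / (fst q - fst p)"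
  have u: "u * (fst q - fst p) = fst x - fst p" using False by (simp add: u_def)
  have "(fst q - fst p) * (snd x - snd p) = (fst q - fst p) * (u * (snd q - snd p))"
    using assms(1) u unfolding orient_def by algebra
  then have "snd x - snd p = u * (snd q - snd p)" using False by simp
  then have "x = (1 - u) *\<^sub>R p + u *\<^sub>R q" using u by (simp add: prod_eq_iff algebra_simps)
  then show thesis by (rule that)
next
  case True
  then have ne: "snd p \<noteq> snd q" using assms(2) by (simp add: prod_eq_iff)
  define u where "u = (snd x - snd p) / (snd q - snd p)"
  have u: "u * (snd q - snd p) = snd x - snd p" using ne by (simp add: u_def)
  have "fst x = fst p" using assms(1) True ne by (simp add: orient_def)
  then have "x = (1 - u) *\<^sub>R p + u *\<^sub>R q" using u True by (simp add: prod_eq_iff algebra_simps)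
  then show thesis by (rule that)
qed

text \<open>If \<open>u > 1\<close>, then \<open>q\<close> lies strictly between \<open>p\<close>
  and the interior point \<open>x\<close>, which makes it interior by convexity;
  \<open>u = 1\<close> gives \<open>q = x\<close>. Exchanging \<open>p\<close> and \<open>q\<close>
  excludes \<open>u \<le> 0\<close>.\<close>

lemma line_interior_parameter:
  fixes p q x :: "'a::euclidean_space"
  assumes S: "convex S" and p: "p \<in> S" "p \<notin> interior S" and q: "q \<in> S" "q \<notin> interior S"
    and x: "x \<in> interior S" "x = (1 - u) *\<^sub>R p + u *\<^sub>R q"
  shows "0 < u \<and> u < 1"
proof -
  have *: False
    if p: "p \<in> S" and q: "q \<notin> interior S" and x: "x = (1 - u) *\<^sub>R p + u *\<^sub>R q" and u: "u \<ge> 1" for p q u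
  proof (cases "u = 1")
    case True
    then show False using x q assms(6) by simp
  next
    case False
    then have u: "u > 1" using u by simp
    have "x - p = u *\<^sub>R (q - p)" using x by (simp add: algebra_simps)
    then have "q - p = (1 / u) *\<^sub>R (x - p)" using u by simp
    then have q_eq: "q = (1 - 1 / u) *\<^sub>R p + (1 / u) *\<^sub>R x" by (simp add: algebra_simps)
    have "x \<noteq> p"
    proof
      assume "x = p"
      then have "q = x" using q_eq by (simp add: scaleR_left_diff_distrib)
      then show False using q assms(6) by simp
    qed
    then have "q \<in> open_segment p x"
      unfolding in_segment using q_eq u by (intro conjI exI[of _ "1 / u"]) simp_all
    then have "q \<in> open_segment x p" by (simp add: open_segment_commute)
    then show False
      using in_interior_closure_convex_segment[OF S assms(6), of p] p q closure_subset by blast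
  qed
  show ?thesis
  proof (rule ccontr)
    assume "\<not> ?thesis"
    then consider "u \<ge> 1" | "1 - u \<ge> 1" by linarith
    then show False
    proof cases
      case 1 then show False by (rule *[OF p(1) q(2) x(2)])
    next
      case 2
      have "x = (1 - (1 - u)) *\<^sub>R q + (1 - u) *\<^sub>R p" using x(2) by simp
      then show False using 2 by (rule *[OF q(1) p(2)])
    qed
  qed
qed

lemma exists_consecutive_segment:
  fixes p q :: "'a::real_normed_vector"
  assumes A: "finite A" and pq: "p \<noteq> q" "p \<in> A" "q \<in> A" and x: "x \<in> closed_segment p q"
  obtains a b where "a \<in> A" "b \<in> A" "a \<noteq> b" "a \<in> closed_segment p q" "b \<in> closed_segment p q"
    "x \<in> closed_segment a b" "open_segment a b \<inter> A = {}"
proof -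
  define f where "f t = p + t *\<^sub>R (q - p)" for t
  have inj: "inj f" using pq(1) by (auto simp: f_def inj_def)
  have f01: "f 0 = p" "f 1 = q" by (auto simp: f_def)
  have seg: "closed_segment (f s) (f t) = f ` {s..t}" if "s \<le> t" for s t
  proof -
    have "linear (\<lambda>t::real. t *\<^sub>R (q - p))" by (intro linearI) (auto simp: algebra_simps)
    then have "closed_segment (s *\<^sub>R (q - p)) (t *\<^sub>R (q - p)) = (\<lambda>t. t *\<^sub>R (q - p)) ` closed_segment s t"
      by (rule closed_segment_linear_image)
    then have "closed_segment (f s) (f t) = f ` closed_segment s t"
      by (simp add: f_def closed_segment_translation image_image)
    then show ?thesis using that by (simp add: closed_segment_eq_real_ivl)
  qed
  define T where "T = {t. f t \<in> A}"
  have "finite T"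
    using finite_vimageI[OF A inj] by (simp add: T_def vimage_def)
  obtain t where t: "x = f t" "0 \<le> t" "t \<le> 1"
    using x seg[of 0 1] f01 by auto
  obtain s u where su: "s \<in> T" "u \<in> T" "0 \<le> s" "u \<le> 1" "s < u" "s \<le> t" "t \<le> u" "\<And>v. v \<in> T \<Longrightarrow> s < v \<Longrightarrow> v < u \<Longrightarrow> False"
  \<comment> \<open>The neighbours of \<open>t\<close> are the last mark up to \<open>t\<close> and
    the first one after it. At \<open>t = 1\<close> no mark follows, so the last piece before 1 is
    taken.\<close>
  proof (cases "t < 1")
    case True
    define s where "s = Max (T \<inter> {0..t})"
    define u where "u = Min (T \<inter> {t<..1})"
    have ne: "0 \<in> T \<inter> {0..t}" "1 \<in> T \<inter> {t<..1}" using True t pq f01 by (auto simp: T_def)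
    have s: "s \<in> T \<inter> {0..t}" unfolding s_def using ne \<open>finite T\<close> by (intro Max_in) auto
    have u: "u \<in> T \<inter> {t<..1}" unfolding u_def using ne \<open>finite T\<close> by (intro Min_in) auto
    have "False" if "v \<in> T" "s < v" "v < u" for v
    proof (cases "v \<le> t")
      case True
      then have "v \<le> s" unfolding s_def using that s \<open>finite T\<close> by (intro Max_ge) auto
      then show False using that by simp
    next
      case False
      then have "u \<le> v" unfolding u_def using that u \<open>finite T\<close> by (intro Min_le) auto
      then show False using that by simp
    qed
    then show thesis using s u that[of s u] by auto
  next
    case False
    then have "t = 1" using t by simp
    define s where "s = Max (T \<inter> {0..<1})"
    have ne: "0 \<in> T \<inter> {0..<1}" "1 \<in> T" using pq f01 by (auto simp: T_def)
    have s: "s \<in> T \<inter> {0..<1}" unfolding s_def using ne \<open>finite T\<close> by (intro Max_in) auto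
    have "False" if "v \<in> T" "s < v" "v < 1" for v
    proof -
      have "v \<le> s" unfolding s_def using that s \<open>finite T\<close> by (intro Max_ge) auto
      then show False using that by simp
    qed
    then show thesis using s ne \<open>t = 1\<close> that[of s 1] by auto
  qed
  show thesis
  proof (rule that[of "f s" "f u"])
    show "f s \<in> A" "f u \<in> A" using su by (auto simp: T_def)
    show "f s \<noteq> f u" using inj su(5) by (auto dest: injD)
    show "f s \<in> closed_segment p q" "f u \<in> closed_segment p q"
      using seg[of 0 1] f01 su by auto
    show "x \<in> closed_segment (f s) (f u)" using seg[of s u] su t by auto
    show "open_segment (f s) (f u) \<inter> A = {}"
    proof (rule ccontr)
      assume "open_segment (f s) (f u) \<inter> A \<noteq> {}"
      then obtain v where v: "s \<le> v" "v \<le> u" "f v \<noteq> f s" "f v \<noteq> f u" "f v \<in> A"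
        using seg[of s u] su(5) by (fastforce simp: open_segment_def)
      then have "v \<noteq> s" "v \<noteq> u" by auto
      then show False using v su(8)[of v] by (auto simp: T_def)
    qed
  qed
qed

text \<open>Edges only subdivide chords. Finiteness of the nodes guarantees that each point of a
  chord lies between two consecutive ones.\<close>

lemma Union_BC_edges:
  assumes "finite (BC_nodes m n \<delta>)"
  shows "\<Union> (BC_edges m n \<delta>) = \<Union> (chords m n \<delta>)"
proof (intro equalityI subsetI)
  fix x assume "x \<in> \<Union> (BC_edges m n \<delta>)"
  then obtain p q c where "c \<in> chords m n \<delta>" "p \<in> c" "q \<in> c" "x \<in> closed_segment p q"
    by (auto simp: BC_edges_def)
  moreover from this have "closed_segment p q \<subseteq> c"
    by (intro closed_segment_subset) (auto simp: chords_def)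
  ultimately show "x \<in> \<Union> (chords m n \<delta>)" by blast
next
  fix x assume "x \<in> \<Union> (chords m n \<delta>)"
  then obtain p q where pq: "p \<in> boundary_nodes m n \<delta>" "q \<in> boundary_nodes m n \<delta>" "p \<noteq> q"
    "x \<in> closed_segment p q" by (auto simp: chords_def)
  have nodes: "p \<in> BC_nodes m n \<delta>" "q \<in> BC_nodes m n \<delta>" using pq by (auto simp: BC_nodes_def)
  obtain a b where "a \<in> BC_nodes m n \<delta>" "b \<in> BC_nodes m n \<delta>" "a \<noteq> b"
    "a \<in> closed_segment p q" "b \<in> closed_segment p q"
    "x \<in> closed_segment a b" "open_segment a b \<inter> BC_nodes m n \<delta> = {}"
    using exists_consecutive_segment[OF assms pq(3) _ _ pq(4)] nodes by blast
  moreover have "closed_segment p q \<in> chords m n \<delta>" unfolding chords_def using pq(1-3) by blast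
  ultimately have "closed_segment a b \<in> BC_edges m n \<delta>"
    unfolding BC_edges_def by blast
  then show "x \<in> \<Union> (BC_edges m n \<delta>)" using \<open>x \<in> closed_segment a b\<close> by blast
qed

subsection \<open>Inner chords and their crossings\<close>

text \<open>Adjacent sides share one corner and opposite sides none; this supplies the overlap bound
  for \<open>card_subsets_inter_less\<close>.\<close>

lemma side_params_inter:
  assumes "m \<ge> 1" "n \<ge> 1" "r \<noteq> r'"
    "x \<in> side_params m n r \<inter> side_params m n r'" "y \<in> side_params m n r \<inter> side_params m n r'"
  shows "x = y"
  using assms by (cases r; cases r') auto

context bc_graph
begin

definition params :: "real set" where
  "params = {t\<in>{0..<2 * real n + 2 * real m}. perim m n t \<in> boundary_nodes m n \<delta>}"

definition same_side :: "real \<Rightarrow> real \<Rightarrow> bool" where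
  "same_side s t \<longleftrightarrow> (\<exists>r. s \<in> side_params m n r \<and> t \<in> side_params m n r)"

text \<open>Increasing order of the parameters records each chord once.\<close>

definition inner_chords :: "(real \<times> real) set" where
  "inner_chords = {(s, t). s \<in> params \<and> t \<in> params \<and> s < t \<and> \<not> same_side s t}"

definition chord_form :: "real \<times> real \<Rightarrow> real \<times> real \<Rightarrow> real" where
  "chord_form i = orient (perim m n (fst i)) (perim m n (snd i))"

text \<open>Deliberately one-sided: the chord that starts first is named first, which makes the
  relation asymmetric as \<open>L\<close> has to be. Strictness excludes common endpoints.\<close>

definition interleaved :: "real \<times> real \<Rightarrow> real \<times> real \<Rightarrow> bool" where
  "interleaved i j \<longleftrightarrow> fst i < fst j \<and> fst j < snd i \<and> snd i < snd j"

lemma params_bounds: "t \<in> params \<Longrightarrow> 0 \<le> t" "t \<in> params \<Longrightarrow> t < 2 * real n + 2 * real m"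
  by (auto simp: params_def)

lemma bij_betw_perim: "bij_betw (perim m n) params (boundary_nodes m n \<delta>)"
proof (rule bij_betw_imageI)
  show "inj_on (perim m n) params"
    by (rule inj_on_subset[OF inj_on_perim[OF m_pos n_pos]]) (auto simp: params_def)
  have "boundary_nodes m n \<delta> \<subseteq> perim m n ` {0..<2 * real n + 2 * real m}"
    using boundary_nodes_subset perim_image[OF m_pos n_pos] by simp
  then show "perim m n ` params = boundary_nodes m n \<delta>"
    unfolding params_def by blast
qed

lemma finite_boundary_nodes: "finite (boundary_nodes m n \<delta>)"
  by (simp add: boundary_nodes_eq finite_corners finite_inner_nodes)

lemma finite_params: "finite params"
  using bij_betw_finite[OF bij_betw_perim] finite_boundary_nodes by simp

lemma card_params: "card params = 2 * m + 2 * n"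
  using bij_betw_same_card[OF bij_betw_perim] card_boundary_nodes by simp

lemma perim_side_line_params:
  "t \<in> params \<Longrightarrow> perim m n t \<in> side_line m n s \<longleftrightarrow> t \<in> side_params m n s"
  using perim_side_line_iff[OF m_pos n_pos] params_bounds by blast

lemma card_params_side: "card (params \<inter> side_params m n s) = side_length m n s + 1"
proof -
  have image: "perim m n ` params = boundary_nodes m n \<delta>"
    using bij_betw_perim by (rule bij_betw_imp_surj_on)
  have "perim m n ` (params \<inter> side_params m n s) = boundary_nodes m n \<delta> \<inter> side_line m n s"
    unfolding image[symmetric] by (auto simp: perim_side_line_params)
  moreover have "inj_on (perim m n) (params \<inter> side_params m n s)"
    using bij_betw_imp_inj_on[OF bij_betw_perim] by (rule inj_on_subset) simp
  then have "card (perim m n ` (params \<inter> side_params m n s)) = card (params \<inter> side_params m n s)"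
    by (rule card_image)
  ultimately show ?thesis
    using card_boundary_nodes_side_line by simp
qed

lemma perim_inj: "s \<in> params \<Longrightarrow> t \<in> params \<Longrightarrow> perim m n s = perim m n t \<Longrightarrow> s = t"
  using bij_betw_imp_inj_on[OF bij_betw_perim] by (rule inj_onD)

lemma perim_frontier:
  assumes "t \<in> params"
  shows "perim m n t \<in> rectangle m n" "perim m n t \<notin> interior (rectangle m n)"
proof -
  have "perim m n t \<in> rectangle m n \<inter> (\<Union>s. side_line m n s)"
    using assms boundary_nodes_subset by (auto simp: params_def)
  then show "perim m n t \<in> rectangle m n" "perim m n t \<notin> interior (rectangle m n)"
    by (auto simp: interior_rectangle_iff)
qed

lemma inner_chordsD:
  assumes "(s, t) \<in> inner_chords"
  shows "s \<in> params" "t \<in> params" "s < t" "\<not> same_side s t" "perim m n s \<noteq> perim m n t"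
  using assms perim_inj[of s t] by (auto simp: inner_chords_def)

text \<open>Since \<open>s\<close> and \<open>t\<close> share no side, no third node is collinear
  with them on a side. Placing \<open>u\<close> before \<open>s\<close> or after \<open>t\<close>
  gives the same cyclic order, hence the same sign.\<close>

lemma chord_form_pos:
  assumes "(s, t) \<in> inner_chords" "u \<in> params" "u < s \<or> t < u"
  shows "chord_form (s, t) (perim m n u) > 0"
proof -
  note i = inner_chordsD[OF assms(1)]
  have "\<not> (\<exists>r. s \<in> side_params m n r \<and> t \<in> side_params m n r \<and> u \<in> side_params m n r)"
    using i(4) by (auto simp: same_side_def)
  then show ?thesis
    using assms(3) orient_perim_pos[OF m_pos n_pos, of u s t] orient_perim_pos[OF m_pos n_pos, of s t u]
      i params_bounds assms(2) by (auto simp: chord_form_def orient_cyclic)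
qed

text \<open>A node between \<open>s\<close> and \<open>t\<close> reverses the cyclic order, so the
  sign flips.\<close>

lemma chord_form_neg:
  assumes "(s, t) \<in> inner_chords" "u \<in> params" "s < u" "u < t"
  shows "chord_form (s, t) (perim m n u) < 0"
proof -
  note i = inner_chordsD[OF assms(1)]
  have "\<not> (\<exists>r. s \<in> side_params m n r \<and> u \<in> side_params m n r \<and> t \<in> side_params m n r)"
    using i(4) by (auto simp: same_side_def)
  then have "orient (perim m n s) (perim m n u) (perim m n t) > 0"
    using orient_perim_pos[OF m_pos n_pos, of s u t] i params_bounds assms(2-4) by blast
  then show ?thesis
    using orient_swap[of "perim m n s" "perim m n u" "perim m n t"] by (simp add: chord_form_def)
qed

lemma chord_form_end:
  "chord_form (s, t) (perim m n s) = 0" "chord_form (s, t) (perim m n t) = 0"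
  by (auto simp: chord_form_def orient_def)

lemma chord_form_eq_0_iff:
  assumes "(s, t) \<in> inner_chords" "u \<in> params"
  shows "chord_form (s, t) (perim m n u) = 0 \<longleftrightarrow> u = s \<or> u = t"
proof -
  consider "u < s \<or> t < u" | "s < u" "u < t" | "u = s \<or> u = t" by linarith
  then show ?thesis
  proof cases
    case 1
    then have "chord_form (s, t) (perim m n u) > 0" by (rule chord_form_pos[OF assms])
    then show ?thesis using 1 inner_chordsD(3)[OF assms(1)] by auto
  next
    case 2
    then have "chord_form (s, t) (perim m n u) < 0" by (rule chord_form_neg[OF assms])
    then show ?thesis using 2 by auto
  next
    case 3
    then show ?thesis using chord_form_end by auto
  qed
qed

lemma chord_form_convex_comb:
  "chord_form i ((1 - u) *\<^sub>R x + u *\<^sub>R y) = (1 - u) * chord_form i x + u * chord_form i y"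
  by (simp add: chord_form_def orient_convex_comb)

lemma inner_chord_interior:
  assumes "(s, t) \<in> inner_chords" "0 < u" "u < 1"
  shows "(1 - u) *\<^sub>R perim m n s + u *\<^sub>R perim m n t \<in> interior (rectangle m n)"
  using inner_chordsD[OF assms(1)] perim_frontier perim_side_line_params assms(2,3)
  by (intro segment_interior_rectangle) (auto simp: same_side_def)

text \<open>Beyond its two boundary nodes the line has left the interior of the convex rectangle, so
  inside it line and chord agree.\<close>

lemma inner_chord_zeroE:
  assumes "(s, t) \<in> inner_chords" "x \<in> interior (rectangle m n)" "chord_form (s, t) x = 0"
  obtains u where "0 < u" "u < 1" "x = (1 - u) *\<^sub>R perim m n s + u *\<^sub>R perim m n t"
proof -
  note i = inner_chordsD[OF assms(1)]
  obtain u where u: "x = (1 - u) *\<^sub>R perim m n s + u *\<^sub>R perim m n t"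
    using orient_eq_0_imp_on_line[of "perim m n s" "perim m n t" x] assms(3) i(5)
    by (auto simp: chord_form_def)
  have "convex (rectangle m n)" by (simp add: rectangle_def)
  then have "0 < u \<and> u < 1"
    using line_interior_parameter[OF _ perim_frontier[OF i(1)] perim_frontier[OF i(2)] assms(2) u]
    by blast
  then show thesis using that u by blast
qed

text \<open>The start of \<open>i\<close> lies outside the parameter range of \<open>j\<close> and
  its end inside, so the form of \<open>j\<close> changes sign along \<open>i\<close>.\<close>

lemma interleaved_imp_cross:
  assumes "i \<in> inner_chords" "j \<in> inner_chords" "interleaved i j"
  shows "\<exists>x\<in>interior (rectangle m n). chord_form i x = 0 \<and> chord_form j x = 0"
proof -
  obtain s t u v where ij: "i = (s, t)" "j = (u, v)" by (cases i; cases j)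
  have o: "s < u" "u < t" "t < v" using assms(3) by (auto simp: interleaved_def ij)
  note i = inner_chordsD[OF assms(1)[unfolded ij]]
  define a b where "a = chord_form j (perim m n s)" and "b = chord_form j (perim m n t)"
  have a: "a > 0" unfolding a_def ij using chord_form_pos assms(2) i o by (simp add: ij)
  have b: "b < 0" unfolding b_def ij using chord_form_neg assms(2) i o by (simp add: ij)
  \<comment> \<open>The zero of the affine function running from \<open>a\<close> at 0 to
    \<open>b\<close> at 1.\<close>
  define w where "w = a / (a - b)"
  have w: "0 < w" "w < 1" using a b by (auto simp: w_def field_simps)
  define x where "x = (1 - w) *\<^sub>R perim m n s + w *\<^sub>R perim m n t"
  have "x \<in> interior (rectangle m n)"
    unfolding x_def using inner_chord_interior assms(1) w by (simp add: ij)
  moreover have "chord_form i x = 0"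
    by (simp add: x_def chord_form_convex_comb ij chord_form_end)
  moreover have "chord_form j x = a - w * (a - b)"
    unfolding x_def chord_form_convex_comb a_def[symmetric] b_def[symmetric] by (simp add: algebra_simps)
  then have "chord_form j x = 0" using a b by (simp add: w_def)
  ultimately show ?thesis by blast
qed

text \<open>Among the nodes, the form of \<open>j\<close> vanishes only at the two ends of
  \<open>j\<close>; two different chords cannot have both ends in common. This is what keeps
  different chords off the same line.\<close>

lemma inner_chord_endpoint_off:
  assumes "(s, t) \<in> inner_chords" "j \<in> inner_chords" "(s, t) \<noteq> j"
  shows "chord_form j (perim m n s) \<noteq> 0 \<or> chord_form j (perim m n t) \<noteq> 0"
proof (rule ccontr)
  assume zero: "\<not> ?thesis"
  obtain u v where j: "j = (u, v)" by (cases j)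
  note i = inner_chordsD[OF assms(1)]
  have "s = u \<or> s = v" "t = u \<or> t = v"
    using zero chord_form_eq_0_iff[OF assms(2)[unfolded j]] i(1,2) by (simp_all add: j)
  moreover have "s < t" "u < v"
    using i(3) inner_chordsD(3)[OF assms(2)[unfolded j]] by simp_all
  ultimately show False using assms(3) by (auto simp: j)
qed

text \<open>The form of \<open>j\<close> vanishes at a strict mean of its values \<open>a\<close>
  and \<open>b\<close> at the ends of \<open>i\<close>, and these are not both zero. So they have
  opposite strict signs: one end lies strictly between \<open>u\<close> and \<open>v\<close>, the
  other strictly outside.\<close>

lemma cross_imp_interleaved:
  assumes "i \<in> inner_chords" "j \<in> inner_chords" "i \<noteq> j"
    and x: "x \<in> interior (rectangle m n)" "chord_form i x = 0" "chord_form j x = 0"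
  shows "interleaved i j \<or> interleaved j i"
proof -
  obtain s t u v where ij: "i = (s, t)" "j = (u, v)" by (cases i; cases j)
  note i = inner_chordsD[OF assms(1)[unfolded ij(1)]] and j = inner_chordsD[OF assms(2)[unfolded ij(2)]]
  define a b where "a = chord_form j (perim m n s)" and "b = chord_form j (perim m n t)"
  obtain w where w: "0 < w" "w < 1" "x = (1 - w) *\<^sub>R perim m n s + w *\<^sub>R perim m n t"
    using inner_chord_zeroE[OF assms(1)[unfolded ij(1)] x(1) x(2)[unfolded ij(1)]] by blast
  have comb: "(1 - w) * a + w * b = 0"
    using x(3) unfolding w(3) chord_form_convex_comb a_def b_def .
  have ab: "a \<noteq> 0 \<or> b \<noteq> 0"
    unfolding a_def b_def using inner_chord_endpoint_off assms(1-3) by (simp add: ij)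
  have J: "(u, v) \<in> inner_chords" using assms(2) ij by simp
  \<comment> \<open>The weak inequalities include the ends of \<open>j\<close>, so that shared
    endpoints are excluded together with the non-interleaved positions.\<close>
  have outside: "chord_form j (perim m n r) \<ge> 0" if "r \<in> params" "r \<le> u \<or> v \<le> r" for r
    using chord_form_pos[OF J that(1)] chord_form_end that(2) unfolding ij(2)
    by (cases "r = u \<or> r = v") (auto simp: less_le)
  have inside: "chord_form j (perim m n r) \<le> 0" if "r \<in> params" "u \<le> r" "r \<le> v" for r
    using chord_form_neg[OF J that(1)] chord_form_end that(2,3) unfolding ij(2)
    by (cases "r = u \<or> r = v") (auto simp: less_le)
  have pos: "(1 - w) * p + w * q > 0" if "p \<ge> 0" "q \<ge> 0" "p \<noteq> 0 \<or> q \<noteq> 0" for p q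
    using that w by (cases "p = 0") (auto intro: add_pos_nonneg)
  have "\<not> (a \<ge> 0 \<and> b \<ge> 0)"
    using pos[of a b] ab comb by auto
  moreover have "\<not> (a \<le> 0 \<and> b \<le> 0)"
    using pos[of "- a" "- b"] ab comb by auto
  ultimately have "\<not> ((s \<le> u \<or> v \<le> s) \<and> (t \<le> u \<or> v \<le> t))" "\<not> ((u \<le> s \<and> s \<le> v) \<and> (u \<le> t \<and> t \<le> v))"
    using outside[OF i(1)] outside[OF i(2)] inside[OF i(1)] inside[OF i(2)]
    unfolding a_def b_def by argo+
  then show ?thesis using i(3) j(3) unfolding interleaved_def ij by auto
qed

text \<open>Parallel lines with a common point coincide; then the form of \<open>j\<close> would
  vanish at both ends of \<open>i\<close>. The common point may lie anywhere in the plane, as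
  \<open>finite_BC_nodes\<close> requires.\<close>

lemma crossing_chords_independent:
  assumes "i \<in> inner_chords" "j \<in> inner_chords" "i \<noteq> j"
    and x: "chord_form i x = 0" "chord_form j x = 0"
  defines "a \<equiv> \<lambda>i. normal (perim m n (fst i)) (perim m n (snd i))"
  shows "fst (a i) * snd (a j) - snd (a i) * fst (a j) \<noteq> 0"
proof
  assume det: "fst (a i) * snd (a j) - snd (a i) * fst (a j) = 0"
  obtain s t where i: "i = (s, t)" by (cases i)
  have diff: "chord_form k y = fst (a k) * fst (y - z) + snd (a k) * snd (y - z)"
    if "chord_form k z = 0" for k y z
    using that by (simp add: chord_form_def a_def orient_eq_normal inner_prod_def algebra_simps)
  have a: "a i \<noteq> 0"
    using inner_chordsD(5)[of s t] assms(1)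
    by (auto simp: a_def normal_def i prod_eq_iff zero_prod_def)
  have "chord_form j y = 0" if y: "chord_form i y = 0" for y
  proof -
    have 1: "fst (a i) * fst (y - x) + snd (a i) * snd (y - x) = 0"
      using diff[OF x(1), of y] y by simp
    have "fst (a i) * chord_form j y = 0" "snd (a i) * chord_form j y = 0"
      unfolding diff[OF x(2)] using 1 det by algebra+
    then show ?thesis using a by (auto simp: prod_eq_iff)
  qed
  then show False
    using inner_chord_endpoint_off[of s t j] assms(1-3) chord_form_end by (auto simp: i)
qed

end

lemma convex_side_line: "convex (side_line m n s)"
  by (cases s) (auto simp: convex_alt algebra_simps)

lemma side_params_between:
  assumes "x < y" "y < z" "x \<in> side_params m n r" "z \<in> side_params m n r" "r \<noteq> West"
  shows "y \<in> side_params m n r"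
  using assms by (cases r) auto

section \<open>The numbers of inner chords and of crossings\<close>

context bc_graph
begin

definition crossings :: "((real \<times> real) \<times> (real \<times> real)) set" where
  "crossings = {(i, j). i \<in> inner_chords \<and> j \<in> inner_chords \<and> interleaved i j}"

definition chord_of :: "real \<times> real \<Rightarrow> (real \<times> real) set" where
  "chord_of i = closed_segment (perim m n (fst i)) (perim m n (snd i))"

lemma card_params_side_inter:
  assumes "r \<noteq> r'"
  shows "card (params \<inter> side_params m n r \<inter> (params \<inter> side_params m n r')) \<le> 1"
  using finite_params side_params_inter[OF m_pos n_pos assms]
  by (simp add: card_le_Suc0_iff_eq)

lemma card_inner_chords:
  "real (card inner_chords) =
    real ((2 * m + 2 * n) choose 2) - 2 * real ((m + 1) choose 2) - 2 * real ((n + 1) choose 2)"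
proof -
  let ?P = "\<lambda>X. \<forall>r. card (X \<inter> (params \<inter> side_params m n r)) < 2"
  have two: "card ({a, b} \<inter> X) < 2 \<longleftrightarrow> \<not> (a \<in> X \<and> b \<in> X)" if "a < b" for a b :: real and X
    using that by (cases "a \<in> X"; cases "b \<in> X") (auto simp: Int_insert_left)
  have "?P {a, b} \<longleftrightarrow> \<not> same_side a b" if "a \<in> params" "b \<in> params" "a < b" for a b
    unfolding two[OF that(3)] same_side_def using that(1,2) by blast
  then have "inner_chords = {(a, b). a \<in> params \<and> b \<in> params \<and> a < b \<and> ?P {a, b}}"
    unfolding inner_chords_def by blast
  then have "card inner_chords = card {X. X \<subseteq> params \<and> card X = 2 \<and> ?P X}"
    by (rule arg_cong[where f = card, THEN trans, OF _ card_2_subsets_linorder[of params ?P]])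
  moreover have "card {X. X \<subseteq> params \<and> card X = 2 \<and> ?P X} +
      (\<Sum>r\<in>UNIV. \<Sum>i=2..2. (card (params \<inter> side_params m n r) choose i) *
        (card params - card (params \<inter> side_params m n r) choose (2 - i))) = card params choose 2"
    using finite_params card_params_side_inter by (intro card_subsets_inter_less) auto
  ultimately have "card inner_chords + 2 * ((m + 1) choose 2) + 2 * ((n + 1) choose 2) = (2 * m + 2 * n) choose 2"
    by (simp add: UNIV_side card_params_side card_params)
  then have "real (card inner_chords + 2 * ((m + 1) choose 2) + 2 * ((n + 1) choose 2)) =
      real ((2 * m + 2 * n) choose 2)"
    by (rule arg_cong)
  then show ?thesis unfolding of_nat_add of_nat_mult of_nat_numeral by linarith
qed

text \<open>
  The parameters of a side are consecutive in the cyclic order, so a side containing two opposite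
  members of the quadruple contains one of the members in between.
\<close>

lemma same_side_iff_card_ge_3:
  assumes abcd: "a \<in> params" "b \<in> params" "c \<in> params" "d \<in> params" "a < b" "b < c" "c < d"
  shows "(\<forall>r. card ({a, b, c, d} \<inter> (params \<inter> side_params m n r)) < 3) \<longleftrightarrow>
    \<not> same_side a c \<and> \<not> same_side b d"
proof -
  have three: False
    if "card ({a, b, c, d} \<inter> X) < 3" "{x, y, z} \<subseteq> {a, b, c, d} \<inter> X" "x < y" "y < z" for x y z X
  proof -
    have "card {x, y, z} \<le> card ({a, b, c, d} \<inter> X)"
      using that(2) by (intro card_mono) auto
    then show False using that by simp
  qed
  \<comment> \<open>At most one of \<open>a\<close> and \<open>c\<close> and at most one of
    \<open>b\<close> and \<open>d\<close> remain in \<open>X\<close>.\<close>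
  have two: "card ({a, b, c, d} \<inter> X) < 3" if "\<not> (a \<in> X \<and> c \<in> X)" "\<not> (b \<in> X \<and> d \<in> X)" for X
  proof -
    have "{a, b, c, d} \<inter> X \<subseteq> {if a \<in> X then a else c, if b \<in> X then b else d}"
      using that by auto
    then have "card ({a, b, c, d} \<inter> X) \<le> card {if a \<in> X then a else c, if b \<in> X then b else d}"
      by (intro card_mono) auto
    also have "\<dots> \<le> 2" by (simp add: card_insert_if)
    finally show ?thesis by simp
  qed
  show ?thesis
  proof
    assume *: "\<forall>r. card ({a, b, c, d} \<inter> (params \<inter> side_params m n r)) < 3"
    have False if r: "a \<in> side_params m n r" "c \<in> side_params m n r" for r
    \<comment> \<open>If \<open>a = 0\<close>, then \<open>b\<close> may lie on another side; but
      \<open>c\<close> is in the final stretch of parameters, and so is \<open>d\<close> after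
      it.\<close>
    proof (cases "r = West")
      case True
      then have "d \<in> side_params m n r" using r abcd params_bounds by force
      then show False using three[OF *[rule_format, of r], of a c d] r abcd by simp
    next
      case False
      then have "b \<in> side_params m n r" using r abcd side_params_between by blast
      then show False using three[OF *[rule_format, of r], of a b c] r abcd by simp
    qed
    moreover have False if r: "b \<in> side_params m n r" "d \<in> side_params m n r" for r
    proof -
      have "c \<in> side_params m n r"
      proof (cases "r = West")
        case True
        then show ?thesis using r abcd params_bounds[OF abcd(1)] params_bounds[OF abcd(4)] by auto
      next
        case False
        then show ?thesis using r abcd side_params_between by blast
      qed
      then show False using three[OF *[rule_format, of r], of b c d] r abcd by simp
    qed
    ultimately show "\<not> same_side a c \<and> \<not> same_side b d"
      unfolding same_side_def by blast
  next
    assume "\<not> same_side a c \<and> \<not> same_side b d"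
    then show "\<forall>r. card ({a, b, c, d} \<inter> (params \<inter> side_params m n r)) < 3"
      unfolding same_side_def by (intro allI two) auto
  qed
qed

text \<open>The excluded quadruples have three or four nodes on one side. With exactly three of the
  \<open>m + 1\<close> nodes of a vertical side, the fourth is one of the other
  \<open>m + 2 * n - 1\<close>; horizontal sides are symmetric, and each kind occurs twice.\<close>

lemma card_crossings:
  "real (card crossings) = real ((2 * m + 2 * n) choose 4)
    - 2 * (real ((m + 1) choose 3) * (real m + 2 * real n - 1) + real ((m + 1) choose 4))
    - 2 * (real ((n + 1) choose 3) * (2 * real m + real n - 1) + real ((n + 1) choose 4))"
proof -
  let ?P = "\<lambda>X. \<forall>r. card (X \<inter> (params \<inter> side_params m n r)) < 3"
  have mem: "((a, c), (b, d)) \<in> crossings \<longleftrightarrow>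
      a \<in> params \<and> b \<in> params \<and> c \<in> params \<and> d \<in> params \<and> a < b \<and> b < c \<and> c < d \<and> ?P {a, b, c, d}"
    for a b c d
  proof -
    have "((a, c), (b, d)) \<in> crossings \<longleftrightarrow>
        a \<in> params \<and> b \<in> params \<and> c \<in> params \<and> d \<in> params \<and> a < b \<and> b < c \<and> c < d \<and>
        \<not> same_side a c \<and> \<not> same_side b d"
      unfolding crossings_def inner_chords_def interleaved_def by auto
    then show ?thesis using same_side_iff_card_ge_3[of a b c d] by blast
  qed
  have "crossings = {((a, c), (b, d)). a \<in> params \<and> b \<in> params \<and> c \<in> params \<and> d \<in> params \<and>
      a < b \<and> b < c \<and> c < d \<and> ?P {a, b, c, d}}"
    using mem by (intro set_eqI) (simp add: split_paired_all)
  then have "card crossings = card {X. X \<subseteq> params \<and> card X = 4 \<and> ?P X}"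
    by (rule arg_cong[where f = card, THEN trans, OF _ card_4_subsets_linorder[of params ?P]])
  moreover have "card {X. X \<subseteq> params \<and> card X = 4 \<and> ?P X} +
      (\<Sum>r\<in>UNIV. \<Sum>i=3..4. (card (params \<inter> side_params m n r) choose i) *
        (card params - card (params \<inter> side_params m n r) choose (4 - i))) = card params choose 4"
    using finite_params card_params_side_inter by (intro card_subsets_inter_less) auto
  moreover have "{3..4} = {3, 4::nat}" by auto
  ultimately have "card crossings
      + 2 * (((m + 1) choose 3) * (2 * m + 2 * n - (m + 1)) + ((m + 1) choose 4))
      + 2 * (((n + 1) choose 3) * (2 * m + 2 * n - (n + 1)) + ((n + 1) choose 4)) = (2 * m + 2 * n) choose 4"
    by (simp add: UNIV_side card_params_side card_params)
  then have "real (card crossings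
      + 2 * (((m + 1) choose 3) * (2 * m + 2 * n - (m + 1)) + ((m + 1) choose 4))
      + 2 * (((n + 1) choose 3) * (2 * m + 2 * n - (n + 1)) + ((n + 1) choose 4))) = real ((2 * m + 2 * n) choose 4)"
    by (rule arg_cong)
  moreover have diff: "real (2 * m + 2 * n - (m + 1)) = real m + 2 * real n - 1"
    "real (2 * m + 2 * n - (n + 1)) = 2 * real m + real n - 1"
    using m_pos n_pos by (simp_all add: of_nat_diff)
  ultimately show ?thesis
    unfolding of_nat_add[of "card crossings + _"] of_nat_add[of "card crossings"] of_nat_add[of "_ * _"]
      of_nat_mult of_nat_numeral diff
    by linarith
qed

section \<open>The rectangle without its chords, and the number of cells\<close>

lemma chord_of_in_chords:
  assumes "i \<in> inner_chords"
  shows "chord_of i \<in> chords m n \<delta>"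
proof -
  have i: "(fst i, snd i) \<in> inner_chords" using assms by simp
  have "perim m n (fst i) \<in> boundary_nodes m n \<delta>" "perim m n (snd i) \<in> boundary_nodes m n \<delta>"
    using inner_chordsD(1,2)[OF i] by (simp_all add: params_def)
  then show ?thesis
    unfolding chord_of_def chords_def using inner_chordsD(5)[OF i] by blast
qed

text \<open>A segment determines its two ends. General position speaks of distinct chords as sets,
  whereas the arrangement is indexed by parameter pairs; injectivity connects the two.\<close>

lemma inj_on_chord_of: "inj_on chord_of inner_chords"
proof (rule inj_onI)
  fix i j assume ij: "i \<in> inner_chords" "j \<in> inner_chords" "chord_of i = chord_of j"
  obtain s t u v where st: "i = (s, t)" "j = (u, v)" by (cases i; cases j)
  note i = inner_chordsD[OF ij(1)[unfolded st]] and j = inner_chordsD[OF ij(2)[unfolded st]]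
  have "{perim m n s, perim m n t} = {perim m n u, perim m n v}"
    using ij(3) by (simp add: chord_of_def st closed_segment_eq)
  then have "{s, t} = {u, v}"
    using perim_inj i(1,2) j(1,2) unfolding doubleton_eq_iff by blast
  then show "i = j" using i(3) j(3) by (auto simp: st doubleton_eq_iff)
qed

lemma chords_cases:
  assumes "c \<in> chords m n \<delta>"
  obtains i where "i \<in> inner_chords" "c = chord_of i" | s where "c \<subseteq> side_line m n s"
proof -
  obtain p q where pq: "p \<in> boundary_nodes m n \<delta>" "q \<in> boundary_nodes m n \<delta>" "p \<noteq> q" "c = closed_segment p q"
    using assms unfolding chords_def by blast
  obtain s t where st: "s \<in> params" "t \<in> params" "p = perim m n s" "q = perim m n t"
    using pq(1,2) bij_betw_imp_surj_on[OF bij_betw_perim] by blast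
  show thesis
  proof (cases "same_side s t")
    case True
    then obtain r where "p \<in> side_line m n r" "q \<in> side_line m n r"
      unfolding same_side_def using st perim_side_line_params by blast
    then have "c \<subseteq> side_line m n r"
      unfolding pq(4) by (rule closed_segment_subset[OF _ _ convex_side_line])
    then show thesis by (rule that(2))
  next
    case False
    have "same_side t s = same_side s t" by (auto simp: same_side_def)
    then have "(s < t \<and> (s, t) \<in> inner_chords) \<or> (t < s \<and> (t, s) \<in> inner_chords)"
      using False st pq(3) by (cases s t rule: linorder_cases) (auto simp: inner_chords_def)
    moreover have "chord_of (s, t) = c" "chord_of (t, s) = c"
      using st pq(4) by (simp_all add: chord_of_def closed_segment_commute)
    ultimately show thesis using that(1) by blast
  qed
qed

lemma chord_of_iff_zero:
  assumes "i \<in> inner_chords" "x \<in> interior (rectangle m n)"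
  shows "x \<in> chord_of i \<longleftrightarrow> chord_form i x = 0"
proof -
  obtain s t where i: "i = (s, t)" by (cases i)
  show ?thesis
  proof
    assume "x \<in> chord_of i"
    then obtain u where "x = (1 - u) *\<^sub>R perim m n s + u *\<^sub>R perim m n t"
      by (auto simp: chord_of_def i in_segment)
    then show "chord_form i x = 0" by (simp add: chord_form_convex_comb i chord_form_end)
  next
    assume "chord_form i x = 0"
    then obtain u where "0 < u" "u < 1" "x = (1 - u) *\<^sub>R perim m n s + u *\<^sub>R perim m n t"
      using inner_chord_zeroE[OF assms(1)[unfolded i] assms(2)] unfolding i by blast
    then show "x \<in> chord_of i"
      unfolding chord_of_def i in_segment by (auto intro!: exI[of _ u])
  qed
qed

text \<open>Each side is itself the chord joining its two corners, so removing the chords leaves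
  only interior points.\<close>

lemma rectangle_frontier_subset_chords:
  assumes "x \<in> rectangle m n" "x \<in> side_line m n s"
  shows "x \<in> \<Union> (chords m n \<delta>)"
proof -
  define p q where "p = (case s of West \<Rightarrow> (0, 0) | East \<Rightarrow> (real n, 0) | South \<Rightarrow> (0, 0) | North \<Rightarrow> (0, real m))"
    and "q = (case s of West \<Rightarrow> (0, real m) | East \<Rightarrow> (real n, real m) | South \<Rightarrow> (real n, 0) | North \<Rightarrow> (real n, real m))"
  have "p \<in> corners m n" "q \<in> corners m n"
    by (cases s; simp add: p_def q_def corners_def)+
  moreover have "p \<noteq> q" using m_pos n_pos by (cases s) (auto simp: p_def q_def)
  ultimately have "closed_segment p q \<in> chords m n \<delta>"
    unfolding chords_def boundary_nodes_def by blast
  moreover have "x \<in> closed_segment p q"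
  proof -
    \<comment> \<open>The coordinate along the side, scaled by the length of the side.\<close>
    define u where "u = (if s \<in> {West, East} then snd x / real m else fst x / real n)"
    have "0 \<le> u" "u \<le> 1"
      using assms(1) m_pos n_pos by (cases x; simp add: u_def mem_rectangle)+
    moreover have "x = (1 - u) *\<^sub>R p + u *\<^sub>R q"
      using assms(2) m_pos n_pos by (cases s; cases x) (auto simp: p_def q_def u_def algebra_simps)
    ultimately show ?thesis unfolding in_segment by blast
  qed
  ultimately show ?thesis by blast
qed

lemma rectangle_minus_chords:
  "rectangle m n - \<Union> (chords m n \<delta>) =
    {x \<in> interior (rectangle m n). \<forall>i\<in>inner_chords. chord_form i x \<noteq> 0}"
proof (intro equalityI subsetI)
  fix x assume x: "x \<in> rectangle m n - \<Union> (chords m n \<delta>)"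
  then have "x \<in> interior (rectangle m n)"
    using rectangle_frontier_subset_chords[of x] unfolding interior_rectangle_iff by blast
  moreover have "chord_form i x \<noteq> 0" if "i \<in> inner_chords" for i
    using x chord_of_in_chords[OF that] chord_of_iff_zero[OF that calculation] by blast
  ultimately show "x \<in> {x \<in> interior (rectangle m n). \<forall>i\<in>inner_chords. chord_form i x \<noteq> 0}"
    by blast
next
  fix x assume x: "x \<in> {x \<in> interior (rectangle m n). \<forall>i\<in>inner_chords. chord_form i x \<noteq> 0}"
  have "x \<notin> c" if "c \<in> chords m n \<delta>" for c
    using that
  proof (cases rule: chords_cases)
    case (1 i)
    then show ?thesis using x chord_of_iff_zero by blast
  next
    case (2 s)
    then show ?thesis using x by (auto simp: interior_rectangle_iff)
  qed
  moreover have "x \<in> rectangle m n" using x interior_subset by blast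
  ultimately show "x \<in> rectangle m n - \<Union> (chords m n \<delta>)" by blast
qed

lemma finite_inner_chords: "finite inner_chords"
  by (rule finite_subset[of _ "params \<times> params"]) (auto simp: inner_chords_def finite_params)

text \<open>A node in the interior is a common zero of two different chord forms, and each pair of
  forms has at most one.\<close>

lemma finite_BC_nodes: "finite (BC_nodes m n \<delta>)"
proof -
  define Z where "Z i j = {x. chord_form i x = 0 \<and> chord_form j x = 0}" for i j
  have Z: "finite (Z i j)" if ij: "i \<in> inner_chords" "j \<in> inner_chords" "i \<noteq> j" for i j
  proof (cases "Z i j = {}")
    case False
    then obtain y where y: "chord_form i y = 0" "chord_form j y = 0" by (auto simp: Z_def)
    have "x = y" if x: "x \<in> Z i j" for x
    proof -
      have "x - y = 0"
      proof (rule orthogonal_to_independent[OF crossing_chords_independent[OF ij y]])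
        show "normal (perim m n (fst i)) (perim m n (snd i)) \<bullet> (x - y) = 0"
          "normal (perim m n (fst j)) (perim m n (snd j)) \<bullet> (x - y) = 0"
          using x y by (simp_all add: Z_def chord_form_def orient_eq_normal inner_diff_right)
      qed
      then show ?thesis by simp
    qed
    then have "Z i j \<subseteq> {y}" by blast
    then show ?thesis by (rule finite_subset) simp
  qed simp
  have "BC_nodes m n \<delta> \<subseteq> boundary_nodes m n \<delta> \<union>
      (\<Union>i\<in>inner_chords. \<Union>j\<in>inner_chords - {i}. Z i j)"
  proof
    fix x assume "x \<in> BC_nodes m n \<delta>"
    then consider "x \<in> boundary_nodes m n \<delta>"
      | c d where "x \<in> interior (rectangle m n)" "c \<in> chords m n \<delta>" "d \<in> chords m n \<delta>" "c \<noteq> d" "x \<in> c" "x \<in> d"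
      unfolding BC_nodes_def by blast
    then show "x \<in> boundary_nodes m n \<delta> \<union> (\<Union>i\<in>inner_chords. \<Union>j\<in>inner_chords - {i}. Z i j)"
    proof cases
      case 2
      have *: "\<exists>i\<in>inner_chords. c = chord_of i" if "c \<in> chords m n \<delta>" "x \<in> c" for c
        using that(1)
      proof (cases rule: chords_cases)
        case (2 s)
        then show ?thesis using that \<open>x \<in> interior (rectangle m n)\<close> by (auto simp: interior_rectangle_iff)
      qed blast
      obtain i j where "i \<in> inner_chords" "c = chord_of i" "j \<in> inner_chords" "d = chord_of j"
        using *[of c] *[of d] 2 by blast
      then have "x \<in> Z i j" "i \<noteq> j"
        using 2 chord_of_iff_zero by (auto simp: Z_def)
      then show ?thesis using \<open>i \<in> inner_chords\<close> \<open>j \<in> inner_chords\<close> by blast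
    qed blast
  qed
  moreover have "finite (\<Union>i\<in>inner_chords. \<Union>j\<in>inner_chords - {i}. Z i j)"
    using finite_inner_chords Z by (intro finite_UN_I) auto
  ultimately show ?thesis
    using finite_boundary_nodes finite_subset by blast
qed

lemma card_BC_cells:
  assumes "general_position m n \<delta>"
  shows "card (BC_cells m n \<delta>) = 1 + card inner_chords + card crossings"
proof -
  define C where "C = interior (rectangle m n)"
  define a where "a i = normal (perim m n (fst i)) (perim m n (snd i))" for i
  have h: "chord_form i x = a i \<bullet> x - a i \<bullet> perim m n (fst i)" for i x
    by (simp add: chord_form_def a_def orient_eq_normal)
  have C: "convex C" "open C" unfolding C_def by (simp_all add: rectangle_def convex_interior del: interior_cbox)
  have "card (BC_cells m n \<delta>) = card (components {x\<in>C. \<forall>i\<in>inner_chords. chord_form i x \<noteq> 0})"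
    unfolding BC_cells_def Union_BC_edges[OF finite_BC_nodes] rectangle_minus_chords C_def ..
  also have "\<dots> = card (sign_patterns chord_form C inner_chords)"
    by (rule card_components_sign_patterns[OF h C(1)])
  also have "\<dots> = 1 + card inner_chords + card {(i, j). i \<in> inner_chords \<and> j \<in> inner_chords \<and> interleaved i j}"
  proof (rule card_sign_patterns_plane[OF h C finite_inner_chords])
    have "(real n / 2, real m / 2) \<in> C" using m_pos n_pos by (simp add: C_def interior_rectangle)
    then show "C \<noteq> {}" by blast
  next
    fix i assume i: "i \<in> inner_chords"
    obtain s t where st: "i = (s, t)" by (cases i)
    have "(1 - 1 / 2) *\<^sub>R perim m n s + (1 / 2) *\<^sub>R perim m n t \<in> C"
      unfolding C_def using i by (intro inner_chord_interior) (auto simp: st)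
    moreover have "chord_form i ((1 - 1 / 2) *\<^sub>R perim m n s + (1 / 2) *\<^sub>R perim m n t) = 0"
      unfolding chord_form_convex_comb by (simp add: st chord_form_end)
    ultimately show "\<exists>x\<in>C. chord_form i x = 0" by blast
    show "a i \<noteq> 0"
      using inner_chordsD(5)[of s t] i by (auto simp: a_def normal_def st prod_eq_iff zero_prod_def)
  next
    fix i j x assume "i \<in> inner_chords" "j \<in> inner_chords" "i \<noteq> j" "chord_form i x = 0" "chord_form j x = 0"
    then show "fst (a i) * snd (a j) - snd (a i) * fst (a j) \<noteq> 0"
      unfolding a_def by (rule crossing_chords_independent)
  next
    fix i j k x
    assume ijk: "i \<in> inner_chords" "j \<in> inner_chords" "k \<in> inner_chords" "i \<noteq> j" "i \<noteq> k" "j \<noteq> k"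
      and x: "x \<in> C" "chord_form i x = 0" "chord_form j x = 0"
    \<comment> \<open>Three forms vanishing at \<open>x\<close> would put three distinct chords
      through an interior point, against general position.\<close>
    have "chord_of i \<noteq> chord_of j" "chord_of i \<noteq> chord_of k" "chord_of j \<noteq> chord_of k"
      using inj_onD[OF inj_on_chord_of] ijk by blast+
    then have "x \<notin> chord_of k"
      using assms chord_of_in_chords ijk(1-3) x chord_of_iff_zero
      unfolding general_position_def C_def by blast
    then show "chord_form k x \<noteq> 0"
      using chord_of_iff_zero[OF ijk(3)] x(1) by (simp add: C_def)
  next
    fix i j assume "interleaved i j" then show "\<not> interleaved j i" by (auto simp: interleaved_def)
  next
    fix i j assume "i \<in> inner_chords" "j \<in> inner_chords" "i \<noteq> j"
    then show "(\<exists>x\<in>C. chord_form i x = 0 \<and> chord_form j x = 0) \<longleftrightarrow> interleaved i j \<or> interleaved j i"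
      using interleaved_imp_cross[of i j] interleaved_imp_cross[of j i] cross_imp_interleaved[of i j]
      unfolding C_def by blast
  qed
  finally show ?thesis by (simp add: crossings_def)
qed

end

theorem theorem7p2:
  fixes m n :: nat and \<delta> :: perturbation
  assumes "m \<ge> 1" and "n \<ge> 1"
    and "admissible m n \<delta>" and "general_position m n \<delta>"
  shows "real (card (BC_cells m n \<delta>)) =
    1 / 4 * ((real m - 1)\<^sup>2 * (real m - 2)\<^sup>2 + (real n - 1)\<^sup>2 * (real n - 2)\<^sup>2)
    + 2 * real m * real n * (real m + real n - 3 / 2)\<^sup>2
    + 9 * real m * real n / 2 - 1"
proof -
  interpret bc_graph m n \<delta> using assms(1-3) by unfold_locales
  have "real (card (BC_cells m n \<delta>)) = 1 + real (card inner_chords) + real (card crossings)"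
    using card_BC_cells[OF assms(4)] by simp
  \<comment> \<open>With the binomials expanded, both sides are polynomials in \<open>real m\<close>
    and \<open>real n\<close>.\<close>
  then show ?thesis
    unfolding card_inner_chords card_crossings real_choose_2 real_choose_3 real_choose_4
      of_nat_add of_nat_mult of_nat_numeral of_nat_1
    by (simp add: field_simps power2_eq_square)
qed

end
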